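(* Let $G$ be an abelian group. The compact convex set $\mathcal{P}^{\mathbb{H}}_*(G)$ (with the topology of pointwise convergence) is a Bauer simplex if and only if $G$ has exponent $\le 2$ (equivalently, $G$ is a vector space over $\mathbb{Z}_2$).
   Context: $\mathbb{H}$ is the real quaternion algebra. For an abelian group $G$, $\phi:G\to\mathbb{H}$ is positive definite if for all $k$, $g_i\in G$, $q_i\in\mathbb{H}$, $\sum_{i,j=1}^k\overline{q_i}\,\phi(g_j-g_i)\,q_j$ is a nonnegative real number; $\mathcal{P}^{\mathbb{H}}_*(G)$ is the set of such $\phi$ with $\phi(0)=1$, viewed as a compact convex subset of $\mathbb{H}^G$ with the product (pointwise convergence) topology. A Bauer simplex is a compact convex set $K$ in a locally convex Hausdorff space whose extreme boundary is closed and such that every point of $K$ is the barycenter of a unique Radon probability measure supported on the extreme boundary (equivalently, a Choquet simplex with closed extreme boundary). *)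

theory Defs
  imports "HOL-Analysis.Analysis" "HOL-Probability.Probability"
begin

section \<open>Quaternions (Cayley--Dickson: q = z + w j with z, w complex)\<close>

type_synonym quat = "complex \<times> complex"

definition qone :: quat where "qone = (1, 0)"

text \<open>(z1 + w1 j)(z2 + w2 j) = (z1 z2 - w1 conj w2) + (z1 w2 + w1 conj z2) j\<close>
definition qmult :: "quat \<Rightarrow> quat \<Rightarrow> quat" where
  "qmult p q = (fst p * fst q - snd p * cnj (snd q), fst p * snd q + snd p * cnj (fst q))"

definition qcnj :: "quat \<Rightarrow> quat" where
  "qcnj q = (cnj (fst q), - snd q)"

definition qnonneg_real :: "quat \<Rightarrow> bool" where
  "qnonneg_real q \<longleftrightarrow> Im (fst q) = 0 \<and> snd q = 0 \<and> Re (fst q) \<ge> 0"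

definition quat_pos_def :: "('g::ab_group_add \<Rightarrow> quat) \<Rightarrow> bool" where
  "quat_pos_def \<phi> \<longleftrightarrow>
     (\<forall>(k::nat) (g::nat \<Rightarrow> 'g) (q::nat \<Rightarrow> quat).
        qnonneg_real (\<Sum>i<k. \<Sum>j<k. qmult (qmult (qcnj (q i)) (\<phi> (g j - g i))) (q j)))"

definition PH :: "('g::ab_group_add \<Rightarrow> quat) set" where
  "PH = {\<phi>. quat_pos_def \<phi> \<and> \<phi> 0 = qone}"

definition ptop :: "('g \<Rightarrow> quat) topology" where
  "ptop = product_topology (\<lambda>_. euclidean) UNIV"

definition fconvex :: "('g \<Rightarrow> quat) set \<Rightarrow> bool" where
  "fconvex K \<longleftrightarrow> (\<forall>x\<in>K. \<forall>y\<in>K. \<forall>t::real. 0 \<le> t \<and> t \<le> 1 \<longrightarrow>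
      (\<lambda>g. t *\<^sub>R x g + (1 - t) *\<^sub>R y g) \<in> K)"

definition extreme_boundary :: "('g \<Rightarrow> quat) set \<Rightarrow> ('g \<Rightarrow> quat) set" where
  "extreme_boundary K = {x\<in>K. \<forall>y\<in>K. \<forall>z\<in>K. \<forall>t::real. 0 < t \<and> t < 1 \<and>
      x = (\<lambda>g. t *\<^sub>R y g + (1 - t) *\<^sub>R z g) \<longrightarrow> y = x \<and> z = x}"

definition cont_lin_functional :: "(('g \<Rightarrow> quat) \<Rightarrow> real) \<Rightarrow> bool" where
  "cont_lin_functional f \<longleftrightarrow>
     (\<forall>x y. f (\<lambda>g. x g + y g) = f x + f y) \<and>
     (\<forall>c x. f (\<lambda>g. c *\<^sub>R x g) = c * f x) \<and>
     continuous_map ptop euclideanreal f"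

definition borel_on :: "('g \<Rightarrow> quat) set \<Rightarrow> ('g \<Rightarrow> quat) set set" where
  "borel_on K = sigma_sets K {U. openin (subtopology ptop K) U}"

definition radon_prob_on :: "('g \<Rightarrow> quat) set \<Rightarrow> ('g \<Rightarrow> quat) measure \<Rightarrow> bool" where
  "radon_prob_on K \<mu> \<longleftrightarrow>
     space \<mu> = K \<and> sets \<mu> = borel_on K \<and> prob_space \<mu> \<and>
     (\<forall>A\<in>sets \<mu>. emeasure \<mu> A =
        (SUP C\<in>{C. C \<subseteq> A \<and> compactin (subtopology ptop K) C}. emeasure \<mu> C))"

definition barycenter :: "('g \<Rightarrow> quat) measure \<Rightarrow> ('g \<Rightarrow> quat) \<Rightarrow> bool" where
  "barycenter \<mu> x \<longleftrightarrow>
     (\<forall>f. cont_lin_functional f \<longrightarrow> integrable \<mu> f \<and> f x = (\<integral>y. f y \<partial>\<mu>))"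

definition bauer_simplex :: "('g \<Rightarrow> quat) set \<Rightarrow> bool" where
  "bauer_simplex K \<longleftrightarrow>
     compactin ptop K \<and> fconvex K \<and>
     closedin ptop (extreme_boundary K) \<and>
     (\<forall>x\<in>K. \<exists>!\<mu>. radon_prob_on K \<mu> \<and> emeasure \<mu> (K - extreme_boundary K) = 0
                   \<and> barycenter \<mu> x)"

end

theory Submission
  imports Defs
begin

text \<open>If \<open>G\<close> has an element \<open>g\<close> with \<open>2g \<noteq> 0\<close>, some function in \<open>PH\<close> has a nonzero \<open>j\<close>-component
  at \<open>g\<close>, so a representing measure yields an extreme point \<open>e = z + w j\<close> with \<open>w(g) \<noteq> 0\<close>. Conjugation by
  complex units maps \<open>e\<close> to the extreme points \<open>z + c w j\<close>, \<open>\<bar>c\<bar> = 1\<close>, and \<open>z\<close> is the midpoint both of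
  \<open>z \<plusminus> w j\<close> and of \<open>z \<plusminus> \<i> w j\<close>: uniqueness fails.

  If \<open>G\<close> has exponent 2, the functions in \<open>PH\<close> are real, because \<open>\<phi>(-g)\<close> is the conjugate of
  \<open>\<phi>(g)\<close>. In the group algebra of \<open>G\<close> the elements \<open>(1 \<plusminus> g) / 2\<close> are idempotents, so for finite
  \<open>F \<subseteq> G\<close> a function \<open>r\<close> splits into positive definite pieces indexed by the sign patterns on \<open>F\<close>. Extreme points
  do not split, hence are the characters \<open>G \<rightarrow> {1, -1}\<close>. For a character the piece belonging to a
  pattern is nonzero exactly if the character has that pattern, so the weights of the pieces of \<open>r\<close> are the
  masses that every representing measure must give to the clopen pattern sets. This gives uniqueness, and
  for existence the weights form a content on the cylinder sets of \<open>{1, -1}\<close>-valued functions that extends to a Radon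
  measure.\<close>

section \<open>Regular Borel measures on a Cantor cube from cylinder contents\<close>

text \<open>The pattern prescribed on \<open>F\<close> is encoded by the set \<open>S\<close> of the
  coordinates that are to be \<open>True\<close>. Only \<open>S \<inter> F\<close> matters, so the
  sums below run over \<open>S \<subseteq> F\<close> to count each cylinder once.\<close>

definition cyl :: "'g set \<Rightarrow> 'g set \<Rightarrow> ('g \<Rightarrow> bool) set" where
  "cyl F S = {x. \<forall>g\<in>F. x g \<longleftrightarrow> g \<in> S}"

lemma open_cyl: "finite F \<Longrightarrow> open (cyl F S)"
  using product_topology_basis'[of F "\<lambda>g. {g \<in> S}" "\<lambda>g. g"]
  by (simp add: cyl_def discrete_topology_class.open_discrete)

lemma closed_cyl: "closed (cyl F S)"
proof -
  have eq: "cyl F S = (\<Inter>g\<in>F. {x. x g \<in> {g \<in> S}})"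
    by (auto simp: cyl_def)
  have "closed {x::'a \<Rightarrow> bool. x g \<in> B}" for g B
  proof -
    have "closed ((\<lambda>x::'a \<Rightarrow> bool. x g) -` B)"
      by (intro closed_vimage) (auto simp: closed_def discrete_topology_class.open_discrete)
    then show ?thesis
      by (simp add: vimage_def)
  qed
  then show ?thesis
    unfolding eq by (intro closed_INT) blast
qed

lemma compact_UNIV_fun_bool: "compact (UNIV :: ('g \<Rightarrow> bool) set)"
proof -
  have "compact (UNIV :: bool set)"
    by (intro finite_imp_compact) simp
  then have "compact_space (euclidean :: bool topology)"
    by (simp add: compact_space_def)
  then have "compact_space (product_topology (\<lambda>_::'g. euclidean :: bool topology) UNIV)"
    by (simp add: compact_space_product_topology)
  then show ?thesis
    by (simp add: euclidean_product_topology compact_space_def)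
qed

lemma closed_imp_compact_fun_bool: "closed (A :: ('g \<Rightarrow> bool) set) \<Longrightarrow> compact A"
  using compact_Int_closed[OF compact_UNIV_fun_bool] by simp

text \<open>The standard witness that cylinders are never empty; evaluating an inclusion of
  cylinders at this point turns it into a statement about patterns.\<close>

lemma point_in_cyl: "(\<lambda>g. g \<in> S) \<in> cyl F S"
  by (simp add: cyl_def)

lemma cyl_subset_cyl_iff:
  assumes "F \<subseteq> F'" "S \<subseteq> F"
  shows "cyl F' S' \<subseteq> cyl F S \<longleftrightarrow> S' \<inter> F = S"
proof
  assume "cyl F' S' \<subseteq> cyl F S"
  with point_in_cyl[of S' F'] have "(\<lambda>g. g \<in> S') \<in> cyl F S"
    by blast
  with assms show "S' \<inter> F = S"
    by (auto simp: cyl_def)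
qed (use assms in \<open>auto simp: cyl_def\<close>)

lemma open_contains_cyl:
  assumes "open U" "x \<in> U"
  obtains F where "finite F" "cyl F {g. x g} \<subseteq> U"
proof -
  from assms obtain X where X: "x \<in> Pi\<^sub>E UNIV X" "finite {i. X i \<noteq> UNIV}" "Pi\<^sub>E UNIV X \<subseteq> U"
    using product_topology_open_contains_basis[of "\<lambda>_. euclidean" UNIV U x]
    by (auto simp: open_fun_def)
  have "cyl {i. X i \<noteq> UNIV} {g. x g} \<subseteq> Pi\<^sub>E UNIV X"
  proof
    fix y assume y: "y \<in> cyl {i. X i \<noteq> UNIV} {g. x g}"
    have "y i \<in> X i" for i
      using y X(1) by (cases "X i = UNIV") (auto simp: cyl_def PiE_iff)
    then show "y \<in> Pi\<^sub>E UNIV X"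
      by (simp add: PiE_iff)
  qed
  with X show thesis
    by (intro that[of "{i. X i \<noteq> UNIV}"]) auto
qed

text \<open>A Lebesgue number argument. Around each point of the compact set \<open>A\<close> some
  cylinder lies in a member of \<open>\<U>\<close>; finitely many of these cover \<open>A\<close>,
  and \<open>F'\<close> collects their bases together with \<open>F\<close>. A cylinder over
  \<open>F'\<close> inside \<open>A\<close> has a point in one of them and is then contained in
  it.\<close>

lemma closed_cover_cyl_refinement:
  fixes A :: "('g \<Rightarrow> bool) set"
  assumes "closed A" "finite F" "\<And>U. U \<in> \<U> \<Longrightarrow> open U" "A \<subseteq> \<Union>\<U>"
  shows "\<exists>F'. finite F' \<and> F \<subseteq> F' \<and> (\<forall>S. cyl F' S \<subseteq> A \<longrightarrow> (\<exists>U\<in>\<U>. cyl F' S \<subseteq> U))"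
proof -
  have "\<exists>H U. finite H \<and> U \<in> \<U> \<and> cyl H {g. x g} \<subseteq> U" if "x \<in> A" for x
    using that assms(3,4) open_contains_cyl by (metis UnionE subsetD)
  then obtain H V where HV: "\<And>x. x \<in> A \<Longrightarrow> finite (H x)" "\<And>x. x \<in> A \<Longrightarrow> V x \<in> \<U>"
    "\<And>x. x \<in> A \<Longrightarrow> cyl (H x) {g. x g} \<subseteq> V x"
    by metis
  have "A \<subseteq> (\<Union>x\<in>A. cyl (H x) {g. x g})"
    by (auto simp: cyl_def)
  then obtain D where D: "D \<subseteq> A" "finite D" "A \<subseteq> (\<Union>x\<in>D. cyl (H x) {g. x g})"
    using compactE_image[OF closed_imp_compact_fun_bool[OF assms(1)], of A "\<lambda>x. cyl (H x) {g. x g}"]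
      open_cyl HV(1) by metis
  show ?thesis
  proof (intro exI[of _ "F \<union> (\<Union>x\<in>D. H x)"] conjI allI impI)
    show "finite (F \<union> (\<Union>x\<in>D. H x))"
      using D HV(1) assms(2) by auto
    fix S assume S: "cyl (F \<union> (\<Union>x\<in>D. H x)) S \<subseteq> A"
    with point_in_cyl D(3) obtain x where x: "x \<in> D" "(\<lambda>g. g \<in> S) \<in> cyl (H x) {g. x g}"
      by blast
    then have "cyl (F \<union> (\<Union>x\<in>D. H x)) S \<subseteq> cyl (H x) {g. x g}"
      by (auto simp: cyl_def)
    with x D(1) HV(2,3) show "\<exists>U\<in>\<U>. cyl (F \<union> (\<Union>x\<in>D. H x)) S \<subseteq> U"
      by blast
  qed auto
qed

section \<open>From consistent cylinder masses to a content on open sets\<close>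

text \<open>The finite-dimensional distributions of a probability measure: \<open>m F S\<close> is
  the mass intended for \<open>cyl F S\<close>, and \<open>split\<close> is Kolmogorov consistency,
  stated for one new coordinate at a time.\<close>

locale cylinder_content =
  fixes m :: "'g set \<Rightarrow> 'g set \<Rightarrow> real"
  assumes nonneg: "finite F \<Longrightarrow> S \<subseteq> F \<Longrightarrow> 0 \<le> m F S"
    and split: "finite F \<Longrightarrow> h \<notin> F \<Longrightarrow> S \<subseteq> F \<Longrightarrow>
      m F S = m (insert h F) S + m (insert h F) (insert h S)"
    and total: "m {} {} = 1"
begin

text \<open>Approximation from inside by the cylinders over one fixed base; for open
  \<open>U\<close> the supremum over all bases becomes the measure of \<open>U\<close>.\<close>

definition inner_sum :: "'g set \<Rightarrow> ('g \<Rightarrow> bool) set \<Rightarrow> real" where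
  "inner_sum F U = (\<Sum>S | S \<subseteq> F \<and> cyl F S \<subseteq> U. m F S)"

definition open_content :: "('g \<Rightarrow> bool) set \<Rightarrow> ennreal" where
  "open_content U = (SUP F\<in>{F. finite F}. ennreal (inner_sum F U))"

definition outer_content :: "('g \<Rightarrow> bool) set \<Rightarrow> ennreal" where
  "outer_content E = (INF U\<in>{U. open U \<and> E \<subseteq> U}. open_content U)"

text \<open>Iteration of \<open>split\<close>, by induction over the finite set \<open>D\<close> of
  coordinates that are added to \<open>F\<close>.\<close>

lemma refine:
  assumes "finite F'" "F \<subseteq> F'" "S \<subseteq> F"
  shows "m F S = (\<Sum>S' | S' \<subseteq> F' \<and> S' \<inter> F = S. m F' S')"
proof -
  have "m F S = (\<Sum>S' | S' \<subseteq> F \<union> D \<and> S' \<inter> F = S. m (F \<union> D) S')" if "finite D" "D \<inter> F = {}" for D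
    using that
  proof (induction D rule: finite_induct)
    case empty
    have "{S'. S' \<subseteq> F \<and> S' \<inter> F = S} = {S}"
      using assms(3) by auto
    then show ?case by simp
  next
    case (insert h D)
    have fin: "finite F"
      using assms finite_subset by blast
    let ?A = "{S'. S' \<subseteq> F \<union> D \<and> S' \<inter> F = S}"
    have finA: "finite ?A"
      using fin insert.hyps by (auto intro: finite_subset[of _ "Pow (F \<union> D)"])
    have h: "h \<notin> F \<union> D"
      using insert by auto
    \<comment> \<open>A pattern on the larger base either omits \<open>h\<close> or arises from one
      that omits it by inserting \<open>h\<close>.\<close>
    have eq: "{S'. S' \<subseteq> F \<union> insert h D \<and> S' \<inter> F = S} = ?A \<union> insert h ` ?A"
    proof (intro equalityI subsetI)
      fix S' assume S': "S' \<in> {S'. S' \<subseteq> F \<union> insert h D \<and> S' \<inter> F = S}"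
      show "S' \<in> ?A \<union> insert h ` ?A"
      proof (cases "h \<in> S'")
        case True
        then have "S' = insert h (S' - {h})" "S' - {h} \<in> ?A"
          using S' h by auto
        then show ?thesis by blast
      qed (use S' in auto)
    qed (use h in auto)
    have inj: "inj_on (insert h) ?A"
      using h by (auto simp: inj_on_def)
    have "(\<Sum>S' | S' \<subseteq> F \<union> insert h D \<and> S' \<inter> F = S. m (F \<union> insert h D) S')
        = (\<Sum>S'\<in>?A. m (insert h (F \<union> D)) S') + (\<Sum>S'\<in>insert h ` ?A. m (insert h (F \<union> D)) S')"
      unfolding eq by (subst sum.union_disjoint) (use finA h in auto)
    also have "\<dots> = (\<Sum>S'\<in>?A. m (insert h (F \<union> D)) S' + m (insert h (F \<union> D)) (insert h S'))"
      by (simp add: sum.reindex[OF inj] sum.distrib)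
    also have "\<dots> = (\<Sum>S'\<in>?A. m (F \<union> D) S')"
      by (intro sum.cong refl split[symmetric]) (use fin insert h in auto)
    also have "\<dots> = m F S"
      using insert by auto
    finally show ?case by simp
  qed
  from this[of "F' - F"] assms show ?thesis
    by (simp add: Un_absorb1 Int_commute)
qed

lemma finite_patterns: "finite F \<Longrightarrow> finite {S. S \<subseteq> F \<and> P S}"
  by (rule finite_subset[of _ "Pow F"]) auto

lemma inner_sum_nonneg: "finite F \<Longrightarrow> 0 \<le> inner_sum F U"
  unfolding inner_sum_def by (intro sum_nonneg nonneg) auto

lemma inner_sum_mono_set: "finite F \<Longrightarrow> U \<subseteq> V \<Longrightarrow> inner_sum F U \<le> inner_sum F V"
  unfolding inner_sum_def by (intro sum_mono2 finite_patterns nonneg) auto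

text \<open>By \<open>refine\<close> each summand is distributed over subcylinders with base
  \<open>F'\<close>. These still lie in \<open>U\<close>, and different \<open>S\<close> have
  different subcylinders, so they form part of the sum over \<open>F'\<close>.\<close>

lemma inner_sum_mono:
  assumes "finite F'" "F \<subseteq> F'"
  shows "inner_sum F U \<le> inner_sum F' U"
proof -
  have fin: "finite F"
    using assms finite_subset by blast
  have "inner_sum F U = (\<Sum>S | S \<subseteq> F \<and> cyl F S \<subseteq> U. \<Sum>S' | S' \<subseteq> F' \<and> S' \<inter> F = S. m F' S')"
    unfolding inner_sum_def by (intro sum.cong refl refine assms) auto
  also have "\<dots> = (\<Sum>S'\<in>(\<Union>S\<in>{S. S \<subseteq> F \<and> cyl F S \<subseteq> U}. {S'. S' \<subseteq> F' \<and> S' \<inter> F = S}). m F' S')"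
    by (subst sum.UNION_disjoint) (use fin assms in \<open>auto simp: finite_patterns\<close>)
  also have "\<dots> \<le> inner_sum F' U"
    unfolding inner_sum_def
  proof (intro sum_mono2 finite_patterns assms nonneg)
    show "(\<Union>S\<in>{S. S \<subseteq> F \<and> cyl F S \<subseteq> U}. {S'. S' \<subseteq> F' \<and> S' \<inter> F = S})
        \<subseteq> {S. S \<subseteq> F' \<and> cyl F' S \<subseteq> U}"
    proof
      fix S' assume "S' \<in> (\<Union>S\<in>{S. S \<subseteq> F \<and> cyl F S \<subseteq> U}. {S'. S' \<subseteq> F' \<and> S' \<inter> F = S})"
      then have "S' \<subseteq> F'" "cyl F (S' \<inter> F) \<subseteq> U"
        by auto
      moreover have "cyl F' S' \<subseteq> cyl F (S' \<inter> F)"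
        using cyl_subset_cyl_iff[OF assms(2), of "S' \<inter> F" S'] by simp
      ultimately show "S' \<in> {S. S \<subseteq> F' \<and> cyl F' S \<subseteq> U}"
        by auto
    qed
  qed auto
  finally show ?thesis .
qed

lemma open_content_upper: "finite F \<Longrightarrow> ennreal (inner_sum F U) \<le> open_content U"
  unfolding open_content_def by (intro SUP_upper) auto

lemma open_content_mono: "U \<subseteq> V \<Longrightarrow> open_content U \<le> open_content V"
  unfolding open_content_def by (intro SUP_mono) (auto intro!: inner_sum_mono_set ennreal_leI)

text \<open>For a base containing \<open>F\<close> the cylinders inside \<open>cyl F S\<close> are
  exactly those summed in \<open>refine\<close>, so the inner sum is constantly
  \<open>m F S\<close>; other bases are enlarged by \<open>F\<close> first.\<close>

lemma open_content_cyl: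
  assumes "finite F" "S \<subseteq> F"
  shows "open_content (cyl F S) = m F S"
proof (rule antisym)
  have eq: "inner_sum F' (cyl F S) = m F S" if "finite F'" "F \<subseteq> F'" for F'
    unfolding inner_sum_def refine[OF that assms(2)]
    using cyl_subset_cyl_iff[OF that(2) assms(2)] by (intro sum.cong) auto
  show "open_content (cyl F S) \<le> m F S"
    unfolding open_content_def
  proof (intro SUP_least ennreal_leI)
    fix F' :: "'g set" assume "F' \<in> {F. finite F}"
    with assms show "inner_sum F' (cyl F S) \<le> m F S"
      using inner_sum_mono[of "F' \<union> F" F' "cyl F S"] eq[of "F' \<union> F"] by auto
  qed
  show "m F S \<le> open_content (cyl F S)"
    using open_content_upper[OF assms(1), of "cyl F S"] eq[OF assms(1)] by simp
qed

lemma open_content_empty: "open_content {} = 0"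
proof -
  have "inner_sum F {} = 0" for F
    unfolding inner_sum_def using point_in_cyl by (intro sum.neutral) blast
  then have "open_content {} \<le> 0"
    unfolding open_content_def by (intro SUP_least) simp
  then show ?thesis
    by simp
qed

lemma open_content_UNIV: "open_content UNIV = 1"
  using open_content_cyl[of "{}" "{}"] by (simp add: total cyl_def)

text \<open>Both inner sums are moved to the common base \<open>F \<union> F'\<close>, where no
  cylinder lies in both sets, since cylinders are nonempty.\<close>

lemma open_content_superadditive:
  assumes "U \<inter> V = {}"
  shows "open_content U + open_content V \<le> open_content (U \<union> V)"
proof -
  have "ennreal (inner_sum F U) + ennreal (inner_sum F' V) \<le> open_content (U \<union> V)"
    if F: "finite F" "finite F'" for F F'
  proof -
    let ?H = "F \<union> F'"
    have H: "finite ?H" using F by simp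
    have "ennreal (inner_sum F U) + ennreal (inner_sum F' V)
        \<le> ennreal (inner_sum ?H U) + ennreal (inner_sum ?H V)"
      using H by (intro add_mono ennreal_leI inner_sum_mono) auto
    also have "\<dots> = ennreal (inner_sum ?H U + inner_sum ?H V)"
      using H by (simp add: inner_sum_nonneg)
    also have "\<dots> \<le> ennreal (inner_sum ?H (U \<union> V))"
    proof (rule ennreal_leI)
      have dis: "{S. S \<subseteq> ?H \<and> cyl ?H S \<subseteq> U} \<inter> {S. S \<subseteq> ?H \<and> cyl ?H S \<subseteq> V} = {}"
        using assms point_in_cyl by blast
      have "inner_sum ?H U + inner_sum ?H V
          = (\<Sum>S\<in>{S. S \<subseteq> ?H \<and> cyl ?H S \<subseteq> U} \<union> {S. S \<subseteq> ?H \<and> cyl ?H S \<subseteq> V}. m ?H S)"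
        unfolding inner_sum_def
        by (rule sum.union_disjoint[symmetric, OF finite_patterns[OF H] finite_patterns[OF H] dis])
      also have "\<dots> \<le> inner_sum ?H (U \<union> V)"
        unfolding inner_sum_def by (intro sum_mono2 finite_patterns[OF H] nonneg[OF H]) auto
      finally show "inner_sum ?H U + inner_sum ?H V \<le> inner_sum ?H (U \<union> V)" .
    qed
    also have "\<dots> \<le> open_content (U \<union> V)"
      by (rule open_content_upper[OF H])
    finally show ?thesis .
  qed
  then have "(SUP F\<in>{F. finite F}. ennreal (inner_sum F U) + ennreal (inner_sum F' V))
      \<le> open_content (U \<union> V)" if "finite F'" for F'
    using that by (intro SUP_least) auto
  then have "open_content U + ennreal (inner_sum F' V) \<le> open_content (U \<union> V)" if "finite F'" for F'
    using that unfolding open_content_def[of U] by (subst (asm) ennreal_SUP_add_left) auto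
  then have "(SUP F'\<in>{F. finite F}. open_content U + ennreal (inner_sum F' V)) \<le> open_content (U \<union> V)"
    by (intro SUP_least) auto
  then show ?thesis
    unfolding open_content_def[of V] by (subst ennreal_SUP_add_right) auto
qed

text \<open>Compactness replaces the countable cover by a finite one: the union \<open>A\<close> of
  the finitely many cylinders seen by one inner sum is closed, and over a fine enough base every
  cylinder inside \<open>A\<close> lies in a single \<open>U n\<close>.\<close>

lemma open_content_countably_subadditive:
  fixes U :: "nat \<Rightarrow> ('g \<Rightarrow> bool) set"
  assumes "\<And>n. open (U n)"
  shows "open_content (\<Union>n. U n) \<le> (\<Sum>n. open_content (U n))"
  unfolding open_content_def[of "\<Union>n. U n"]
proof (intro SUP_least)
  fix F :: "'g set" assume "F \<in> {F. finite F}"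
  then have F: "finite F" by simp
  define A where "A = (\<Union>S\<in>{S. S \<subseteq> F \<and> cyl F S \<subseteq> (\<Union>n. U n)}. cyl F S)"
  have clo: "closed A"
    unfolding A_def using F by (intro closed_UN finite_patterns) (auto simp: closed_cyl)
  have sub: "A \<subseteq> \<Union>(range U)"
    by (auto simp: A_def)
  have opn: "open V" if "V \<in> range U" for V
    using that assms by auto
  obtain F' where F': "finite F'" "F \<subseteq> F'"
    "\<And>S. cyl F' S \<subseteq> A \<Longrightarrow> \<exists>V\<in>range U. cyl F' S \<subseteq> V"
    using closed_cover_cyl_refinement[OF clo F opn sub] by blast
  then have "\<forall>S. \<exists>n. cyl F' S \<subseteq> A \<longrightarrow> cyl F' S \<subseteq> U n"
    by blast
  then obtain n where n: "\<And>S. cyl F' S \<subseteq> A \<Longrightarrow> cyl F' S \<subseteq> U (n S)"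
    by metis
  let ?P = "{S. S \<subseteq> F' \<and> cyl F' S \<subseteq> A}"
  have finP: "finite ?P"
    by (rule finite_patterns[OF F'(1)])
  obtain N where N: "\<And>S. S \<in> ?P \<Longrightarrow> n S < N"
    using finite_nat_set_iff_bounded[of "n ` ?P"] finP by auto
  have "inner_sum F (\<Union>n. U n) \<le> inner_sum F A"
    unfolding inner_sum_def A_def by (intro sum_mono2 finite_patterns F nonneg) auto
  also have "\<dots> \<le> inner_sum F' A"
    by (rule inner_sum_mono[OF F'(1,2)])
  \<comment> \<open>Each pattern is charged to the index \<open>n S\<close> of a set containing its
    cylinder; the remaining terms are nonnegative.\<close>
  also have "\<dots> \<le> (\<Sum>S\<in>?P. \<Sum>k<N. if cyl F' S \<subseteq> U k then m F' S else 0)"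
    unfolding inner_sum_def
  proof (rule sum_mono)
    fix S assume S: "S \<in> ?P"
    then have "m F' S = (\<Sum>k\<in>{n S}. if cyl F' S \<subseteq> U k then m F' S else 0)"
      using n by auto
    also have "\<dots> \<le> (\<Sum>k<N. if cyl F' S \<subseteq> U k then m F' S else 0)"
      using S N nonneg[OF F'(1)] by (intro sum_mono2) auto
    finally show "m F' S \<le> (\<Sum>k<N. if cyl F' S \<subseteq> U k then m F' S else 0)" .
  qed
  also have "\<dots> = (\<Sum>k<N. \<Sum>S\<in>?P. if cyl F' S \<subseteq> U k then m F' S else 0)"
    by (rule sum.swap)
  also have "\<dots> \<le> (\<Sum>k<N. inner_sum F' (U k))"
  proof (rule sum_mono)
    fix k
    have "(\<Sum>S\<in>?P. if cyl F' S \<subseteq> U k then m F' S else 0) = (\<Sum>S\<in>{S\<in>?P. cyl F' S \<subseteq> U k}. m F' S)"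
      by (rule sum.inter_filter[OF finP, symmetric])
    also have "\<dots> \<le> inner_sum F' (U k)"
      unfolding inner_sum_def by (intro sum_mono2 finite_patterns F' nonneg) auto
    finally show "(\<Sum>S\<in>?P. if cyl F' S \<subseteq> U k then m F' S else 0) \<le> inner_sum F' (U k)" .
  qed
  finally have "ennreal (inner_sum F (\<Union>n. U n)) \<le> ennreal (\<Sum>k<N. inner_sum F' (U k))"
    by (rule ennreal_leI)
  also have "\<dots> = (\<Sum>k<N. ennreal (inner_sum F' (U k)))"
    by (rule sum_ennreal[symmetric]) (rule inner_sum_nonneg[OF F'(1)])
  also have "\<dots> \<le> (\<Sum>k<N. open_content (U k))"
    by (intro sum_mono open_content_upper F')
  also have "\<dots> \<le> (\<Sum>k. open_content (U k))"
    by (intro sum_le_suminf) auto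
  finally show "ennreal (inner_sum F (\<Union>n. U n)) \<le> (\<Sum>n. open_content (U n))" .
qed

section \<open>Outer measure and Caratheodory extension\<close>

lemma outer_content_open: "open U \<Longrightarrow> outer_content U = open_content U"
  unfolding outer_content_def by (intro antisym INF_lower INF_greatest open_content_mono) auto

lemma outer_content_mono: "A \<subseteq> B \<Longrightarrow> outer_content A \<le> outer_content B"
  unfolding outer_content_def by (intro INF_superset_mono) auto

lemma outer_content_countably_subadditive:
  fixes A :: "nat \<Rightarrow> ('g \<Rightarrow> bool) set"
  shows "outer_content (\<Union>n. A n) \<le> (\<Sum>n. outer_content (A n))"
proof (rule ennreal_le_epsilon)
  fix e :: real assume e: "0 < e" and fin: "(\<Sum>n. outer_content (A n)) < top"
  \<comment> \<open>The tolerance is distributed as \<open>e * (1/2)^Suc n\<close>, which sums to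
    \<open>e\<close>. The inequality is strict because finiteness of the series makes every term
    finite.\<close>
  then have lt: "outer_content (A n) < outer_content (A n) + e * (1/2)^Suc n" for n
    by (auto simp add: less_top dest!: ennreal_suminf_lessD)
  have "\<exists>U. open U \<and> A n \<subseteq> U \<and> open_content U < outer_content (A n) + e * (1/2)^Suc n" for n
    using lt[of n] unfolding outer_content_def[of "A n"] INF_less_iff by auto
  then obtain U where U: "\<And>n. open (U n)" "\<And>n. A n \<subseteq> U n"
    "\<And>n. open_content (U n) < outer_content (A n) + e * (1/2)^Suc n"
    by metis
  have "outer_content (\<Union>n. A n) \<le> open_content (\<Union>n. U n)"
    unfolding outer_content_def using U by (intro INF_lower) auto
  also have "\<dots> \<le> (\<Sum>n. open_content (U n))"
    by (rule open_content_countably_subadditive[OF U(1)])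
  also have "\<dots> \<le> (\<Sum>n. outer_content (A n) + e * (1/2) ^ Suc n)"
    using U(3) by (intro suminf_le) (auto intro: less_imp_le)
  also have "\<dots> = (\<Sum>n. outer_content (A n)) + (\<Sum>n. ennreal e * ennreal ((1/2) ^ Suc n))"
    using e by (subst suminf_add[symmetric])
      (auto simp del: ennreal_suminf_cmult simp add: ennreal_mult[symmetric])
  also have "\<dots> = (\<Sum>n. outer_content (A n)) + e"
    unfolding ennreal_suminf_cmult
    by (subst suminf_ennreal_eq[OF zero_le_power power_half_series]) auto
  finally show "outer_content (\<Union>n. A n) \<le> (\<Sum>n. outer_content (A n)) + e" .
qed

lemma outer_content_empty: "outer_content {} = 0"
  by (simp add: outer_content_open open_content_empty)

lemma outer_measure_space_outer_content: "outer_measure_space UNIV outer_content"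
  unfolding outer_measure_space_def positive_def increasing_def countably_subadditive_def
  using outer_content_empty outer_content_mono outer_content_countably_subadditive by blast

lemma outer_content_subadditive: "outer_content (A \<union> B) \<le> outer_content A + outer_content B"
proof -
  have "sigma_algebra UNIV (UNIV :: ('g \<Rightarrow> bool) set set)"
    using sigma_algebra_Pow[of UNIV] by simp
  then interpret sigma_algebra UNIV "UNIV :: ('g \<Rightarrow> bool) set set" .
  have "subadditive UNIV outer_content"
    using outer_measure_space_outer_content
    unfolding outer_measure_space_def by (intro countably_subadditive_subadditive) auto
  moreover have "outer_content (A \<union> B) = outer_content (A \<union> (B - A))"
    by simp
  moreover have "outer_content (B - A) \<le> outer_content B"
    by (rule outer_content_mono) auto
  ultimately show ?thesis
    unfolding subadditive_def by (metis Diff_disjoint UNIV_I add_left_mono order_trans)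
qed

text \<open>For one inner sum, \<open>E \<inter> V\<close> is replaced by the closed union
  \<open>A\<close> of the cylinders it counts. Then \<open>E - A\<close> is open and contains
  \<open>E - V\<close>, so superadditivity applies to \<open>A\<close> and \<open>E - A\<close>; the
  supremum over \<open>F\<close> recovers \<open>E \<inter> V\<close>.\<close>

lemma open_outer_content_split:
  assumes "open V" "open E"
  shows "outer_content (E \<inter> V) + outer_content (E - V) \<le> outer_content E"
proof -
  have "ennreal (inner_sum F (E \<inter> V)) + outer_content (E - V) \<le> open_content E" if F: "finite F" for F
  proof -
    define A where "A = (\<Union>S\<in>{S. S \<subseteq> F \<and> cyl F S \<subseteq> E \<inter> V}. cyl F S)"
    have clo: "closed A"
      unfolding A_def using F by (intro closed_UN finite_patterns) (auto simp: closed_cyl)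
    have "inner_sum F (E \<inter> V) \<le> inner_sum F A"
      unfolding inner_sum_def A_def by (intro sum_mono2 finite_patterns F nonneg) auto
    then have "ennreal (inner_sum F (E \<inter> V)) \<le> open_content A"
      using open_content_upper[OF F, of A] ennreal_leI order_trans by blast
    moreover have "outer_content (E - V) \<le> open_content (E - A)"
      unfolding outer_content_def
      by (rule INF_lower) (use clo assms in \<open>auto simp: A_def intro: open_Diff\<close>)
    ultimately have "ennreal (inner_sum F (E \<inter> V)) + outer_content (E - V)
        \<le> open_content A + open_content (E - A)"
      by (rule add_mono)
    also have "\<dots> \<le> open_content (A \<union> (E - A))"
      by (rule open_content_superadditive) auto
    also have "A \<union> (E - A) = E"
      by (auto simp: A_def)
    finally show ?thesis .
  qed
  then have "(SUP F\<in>{F. finite F}. ennreal (inner_sum F (E \<inter> V)) + outer_content (E - V)) \<le> open_content E"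
    by (intro SUP_least) auto
  then have "open_content (E \<inter> V) + outer_content (E - V) \<le> open_content E"
    unfolding open_content_def[of "E \<inter> V"] by (subst (asm) ennreal_SUP_add_left) auto
  then show ?thesis
    using assms by (simp add: outer_content_open open_Int)
qed

text \<open>For an arbitrary test set \<open>E\<close> the inequality already known for open test
  sets is applied to the open supersets of \<open>E\<close>, followed by the infimum.\<close>

lemma open_in_lambda_system:
  assumes "open V"
  shows "V \<in> lambda_system UNIV UNIV outer_content"
proof -
  have "outer_content (V \<inter> E) + outer_content ((UNIV - V) \<inter> E) = outer_content E" for E
  proof (rule antisym)
    show "outer_content (V \<inter> E) + outer_content ((UNIV - V) \<inter> E) \<le> outer_content E"
      unfolding outer_content_def[of E]
    proof (rule INF_greatest)
      fix U assume U: "U \<in> {U. open U \<and> E \<subseteq> U}"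
      have "outer_content (V \<inter> E) + outer_content ((UNIV - V) \<inter> E)
          \<le> outer_content (U \<inter> V) + outer_content (U - V)"
        using U by (intro add_mono outer_content_mono) auto
      also have "\<dots> \<le> open_content U"
        using open_outer_content_split[OF assms, of U] U by (simp add: outer_content_open)
      finally show "outer_content (V \<inter> E) + outer_content ((UNIV - V) \<inter> E) \<le> open_content U" .
    qed
    have "E = (V \<inter> E) \<union> ((UNIV - V) \<inter> E)" by auto
    then show "outer_content E \<le> outer_content (V \<inter> E) + outer_content ((UNIV - V) \<inter> E)"
      using outer_content_subadditive by metis
  qed
  then show ?thesis
    by (simp add: lambda_system_def)
qed

text \<open>Caratheodory's construction yields a measure on a sigma-algebra containing the open
  sets. For uncountable index sets the Borel sets exceed the sigma-algebra generated by cylinders,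
  so regularity has to come with the construction: outer regularity is built into
  \<open>outer_content\<close>, and complements turn it into inner regularity.\<close>

theorem regular_borel_measure_exists:
  obtains \<nu> :: "('g \<Rightarrow> bool) measure" where "sets \<nu> = sets borel" "prob_space \<nu>"
    "\<And>F S. finite F \<Longrightarrow> S \<subseteq> F \<Longrightarrow> emeasure \<nu> (cyl F S) = m F S"
    "\<And>A. A \<in> sets borel \<Longrightarrow> emeasure \<nu> A = (SUP C\<in>{C. closed C \<and> C \<subseteq> A}. emeasure \<nu> C)"
proof -
  let ?L = "lambda_system UNIV UNIV outer_content"
  have sa: "sigma_algebra UNIV (UNIV :: ('g \<Rightarrow> bool) set set)"
    using sigma_algebra_Pow[of UNIV] by simp
  have ms: "measure_space UNIV ?L outer_content"
    using sigma_algebra.caratheodory_lemma[OF sa outer_measure_space_outer_content] .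
  then have saL: "sigma_algebra UNIV ?L"
    by (simp add: measure_space_def)
  have borel_L: "sets borel \<subseteq> ?L"
    using sigma_algebra.sigma_sets_subset[OF saL, of "Collect open"] open_in_lambda_system
    by (auto simp: borel_def)
  define \<nu> where "\<nu> = measure_of UNIV (sets borel) outer_content"
  have sets: "sets \<nu> = sets borel"
    unfolding \<nu>_def using sets.sigma_sets_eq[of borel] by (simp add: sets_measure_of)
  have em: "emeasure \<nu> A = outer_content A" if "A \<in> sets borel" for A
    unfolding \<nu>_def
  proof (rule emeasure_measure_of_sigma)
    show "sigma_algebra UNIV (sets borel :: ('g \<Rightarrow> bool) set set)"
      using sets.sigma_algebra_axioms[of borel] by simp
    show "positive (sets borel) outer_content"
      by (simp add: positive_def outer_content_empty)
    show "countably_additive (sets borel) outer_content"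
      using ms borel_L unfolding measure_space_def countably_additive_def by blast
  qed fact
  have sp: "space \<nu> = UNIV"
    using sets_eq_imp_space_eq[OF sets] by simp
  have pr: "prob_space \<nu>"
    by (rule prob_spaceI) (simp add: sp em outer_content_open open_content_UNIV)
  interpret prob_space \<nu> by fact
  show thesis
  proof (rule that[OF sets pr])
    fix F S :: "'g set" assume "finite F" "S \<subseteq> F"
    then show "emeasure \<nu> (cyl F S) = m F S"
      by (simp add: em open_cyl outer_content_open open_content_cyl)
  next
    fix A :: "('g \<Rightarrow> bool) set" assume A: "A \<in> sets borel"
    show "emeasure \<nu> A = (SUP C\<in>{C. closed C \<and> C \<subseteq> A}. emeasure \<nu> C)"
    proof (rule antisym)
      show "emeasure \<nu> A \<le> (SUP C\<in>{C. closed C \<and> C \<subseteq> A}. emeasure \<nu> C)"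
      proof (rule ennreal_le_epsilon)
        fix e :: real assume e: "0 < e"
        have "outer_content (-A) < outer_content (-A) + e"
          using e A em[of "-A", symmetric]
          by (simp add: emeasure_eq_measure ennreal_less_iff flip: ennreal_plus)
        \<comment> \<open>The closed set \<open>-U\<close> is contained in \<open>A\<close> and
          misses at most mass \<open>e\<close> of it.\<close>
        then obtain U where U: "open U" "-A \<subseteq> U" "open_content U < outer_content (-A) + e"
          unfolding outer_content_def[of "-A"] INF_less_iff by auto
        have U': "U \<in> sets \<nu>" "A \<in> sets \<nu>"
          using U A sets by auto
        have "emeasure \<nu> U \<le> emeasure \<nu> (-A) + e"
          using U A em[of U] em[of "-A"] by (simp add: outer_content_open)
        then have "measure \<nu> U \<le> measure \<nu> (-A) + e"
          using e by (simp add: emeasure_eq_measure flip: ennreal_plus)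
        moreover have "measure \<nu> (-A) = 1 - measure \<nu> A" "measure \<nu> (-U) = 1 - measure \<nu> U"
          using prob_compl[OF U'(1)] prob_compl[OF U'(2)] by (simp_all add: sp Compl_eq_Diff_UNIV)
        ultimately have "measure \<nu> A \<le> measure \<nu> (-U) + e"
          by simp
        then have "emeasure \<nu> A \<le> emeasure \<nu> (-U) + e"
          using e by (simp add: emeasure_eq_measure flip: ennreal_plus)
        also have "emeasure \<nu> (-U) \<le> (SUP C\<in>{C. closed C \<and> C \<subseteq> A}. emeasure \<nu> C)"
          using U by (intro SUP_upper) auto
        finally show "emeasure \<nu> A \<le> (SUP C\<in>{C. closed C \<and> C \<subseteq> A}. emeasure \<nu> C) + e"
          by (simp add: add_right_mono)
      qed
      show "(SUP C\<in>{C. closed C \<and> C \<subseteq> A}. emeasure \<nu> C) \<le> emeasure \<nu> A"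
        using A by (intro SUP_least emeasure_mono) (auto simp: sets)
    qed
  qed
qed

end

section \<open>Representing measures need not be unique\<close>

lemma ptop_eq_euclidean: "ptop = euclidean"
  by (simp add: ptop_def euclidean_product_topology)

lemma compact_imp_closed_fun:
  fixes K :: "('a \<Rightarrow> 'b::t2_space) set"
  assumes "compact K"
  shows "closed K"
proof -
  have "Hausdorff_space (euclidean :: 'b topology)"
    unfolding Hausdorff_space_def disjnt_def using hausdorff by auto
  then have "Hausdorff_space (product_topology (\<lambda>_::'a. euclidean :: 'b topology) UNIV)"
    by (simp add: Hausdorff_space_product_topology)
  then show ?thesis
    using assms compactin_imp_closedin[of "euclidean :: ('a \<Rightarrow> 'b) topology" K]
    by (simp add: euclidean_product_topology)
qed

text \<open>Makes the measurability rules for \<open>restrict_space\<close> available for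
  \<open>borel_on\<close>: the trace on \<open>K\<close> of a generated sigma-algebra is generated
  by the traces of its generators.\<close>

lemma borel_on_closed: "closed K \<Longrightarrow> borel_on K = sets (restrict_space borel K)"
proof -
  assume K: "closed K"
  have gen: "{U. openin (subtopology ptop K) U} = (\<inter>) K ` {S. open S}"
    by (auto simp: ptop_eq_euclidean openin_subtopology Int_commute)
  have "sets (restrict_space borel K) = (\<inter>) K ` sigma_sets UNIV {S. open S}"
    by (simp add: sets_restrict_space borel_def)
  also have "\<dots> = sigma_sets K ((\<inter>) K ` {S. open S})"
  proof (rule sigma_sets_Int)
    have "K \<in> sets borel"
      using K by simp
    then show "K \<in> sigma_sets UNIV {S. open S}"
      by (simp add: borel_def)
  qed simp
  finally show ?thesis
    by (simp add: borel_on_def gen)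
qed

lemma closed_in_borel_on:
  assumes "closed K" "closed C" "C \<subseteq> K"
  shows "C \<in> borel_on K"
  using assms by (auto simp: borel_on_closed sets_restrict_space intro!: image_eqI[of _ _ C])

lemma cont_lin_functional_borel_measurable:
  assumes "cont_lin_functional f"
  shows "f \<in> borel_measurable borel"
proof -
  have "continuous_on UNIV f"
    using assms by (simp add: cont_lin_functional_def ptop_eq_euclidean)
  then show ?thesis
    by (rule borel_measurable_continuous_onI)
qed

lemma cont_lin_functional_coordinate:
  assumes "bounded_linear L"
  shows "cont_lin_functional (\<lambda>\<phi>. L (\<phi> g))"
proof -
  interpret bounded_linear L by fact
  have "continuous_on UNIV (\<lambda>\<phi> :: 'a \<Rightarrow> quat. L (\<phi> g))"
    by (intro continuous_on) (rule continuous_on_product_coordinates)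
  then show ?thesis
    by (simp add: cont_lin_functional_def ptop_eq_euclidean add scaleR)
qed

section \<open>Quaternion arithmetic and a non-real positive definite function\<close>

lemma qmult_sum_left: "qmult (\<Sum>i\<in>I. p i) q = (\<Sum>i\<in>I. qmult (p i) q)"
  by (rule prod_eqI)
    (simp_all add: qmult_def fst_sum snd_sum sum_distrib_right sum_subtractf sum.distrib)

lemma qmult_sum_right: "qmult q (\<Sum>i\<in>I. p i) = (\<Sum>i\<in>I. qmult q (p i))"
  by (rule prod_eqI)
    (simp_all add: qmult_def fst_sum snd_sum cnj_sum sum_distrib_left sum_subtractf sum.distrib)

lemma qmult_scaleR_left: "qmult (c *\<^sub>R p) q = c *\<^sub>R qmult p q"
  by (rule prod_eqI) (simp_all add: qmult_def algebra_simps)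

lemma qmult_scaleR_right: "qmult p (c *\<^sub>R q) = c *\<^sub>R qmult p q"
  by (rule prod_eqI) (simp_all add: qmult_def algebra_simps)

lemma qmult_assoc: "qmult (qmult p q) r = qmult p (qmult q r)"
  by (rule prod_eqI) (simp_all add: qmult_def algebra_simps)

lemma qcnj_sum: "qcnj (\<Sum>i\<in>I. p i) = (\<Sum>i\<in>I. qcnj (p i))"
  by (rule prod_eqI) (simp_all add: qcnj_def fst_sum snd_sum cnj_sum sum_negf)

lemma qcnj_qmult: "qcnj (qmult p q) = qmult (qcnj q) (qcnj p)"
  by (rule prod_eqI) (simp_all add: qmult_def qcnj_def algebra_simps)

lemma qnonneg_real_qcnj_mult_self: "qnonneg_real (qmult (qcnj q) q)"
  by (simp add: qnonneg_real_def qmult_def qcnj_def)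

lemma qnonneg_real_sum: "(\<And>i. i \<in> I \<Longrightarrow> qnonneg_real (p i)) \<Longrightarrow> qnonneg_real (\<Sum>i\<in>I. p i)"
  by (simp add: qnonneg_real_def fst_sum snd_sum sum_nonneg)

lemma qnonneg_real_scaleR: "0 \<le> c \<Longrightarrow> qnonneg_real p \<Longrightarrow> qnonneg_real (c *\<^sub>R p)"
  by (simp add: qnonneg_real_def)

text \<open>The quadratic form becomes \<open>c\<close> times the sum over \<open>z\<close> of the
  squared norms of \<open>v z\<close>. In the application \<open>Y x\<close> is the support of
  \<open>z \<mapsto> b (z + x)\<close>, which makes the formal sum over the group finite; as every
  larger finite \<open>Z\<close> is allowed, one \<open>Z\<close> serves all pairs of
  points.\<close>

lemma quat_pos_def_autocorrelation:
  assumes "0 \<le> c" and fin: "\<And>x. finite (Y x)"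
    and eq: "\<And>x y Z. finite Z \<Longrightarrow> Y x \<subseteq> Z \<Longrightarrow>
      \<phi> (y - x) = c *\<^sub>R (\<Sum>z\<in>Z. qmult (qcnj (b (z + x))) (b (z + y)))"
  shows "quat_pos_def \<phi>"
  unfolding quat_pos_def_def
proof (intro allI)
  fix k :: nat and x :: "nat \<Rightarrow> 'a" and q :: "nat \<Rightarrow> quat"
  define Z where "Z = (\<Union>i<k. Y (x i))"
  have Z: "finite Z" "\<And>i. i < k \<Longrightarrow> Y (x i) \<subseteq> Z"
    using fin by (auto simp: Z_def)
  define v where "v z = (\<Sum>i<k. qmult (b (z + x i)) (q i))" for z
  have "(\<Sum>i<k. \<Sum>j<k. qmult (qmult (qcnj (q i)) (\<phi> (x j - x i))) (q j))
      = (\<Sum>i<k. \<Sum>j<k. \<Sum>z\<in>Z. c *\<^sub>R qmult (qcnj (qmult (b (z + x i)) (q i))) (qmult (b (z + x j)) (q j)))"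
    by (intro sum.cong refl)
      (simp add: eq[OF Z(1) Z(2)] qmult_scaleR_left qmult_scaleR_right qmult_sum_left qmult_sum_right
        scaleR_sum_right qcnj_qmult qmult_assoc)
  also have "\<dots> = (\<Sum>z\<in>Z. \<Sum>i<k. \<Sum>j<k. c *\<^sub>R qmult (qcnj (qmult (b (z + x i)) (q i))) (qmult (b (z + x j)) (q j)))"
    unfolding sum.swap[of _ Z] by (rule refl)
  also have "\<dots> = (\<Sum>z\<in>Z. c *\<^sub>R qmult (qcnj (v z)) (v z))"
    unfolding v_def qcnj_sum qmult_sum_left by (simp add: qmult_sum_right scaleR_sum_right)
  finally show "qnonneg_real (\<Sum>i<k. \<Sum>j<k. qmult (qmult (qcnj (q i)) (\<phi> (x j - x i))) (q j))"
    using assms(1) by (auto intro!: qnonneg_real_sum qnonneg_real_scaleR qnonneg_real_qcnj_mult_self)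
qed

text \<open>\<open>\<phi>\<close> is half the autocorrelation of the function \<open>b\<close> with
  value \<open>1\<close> at \<open>0\<close>, \<open>j\<close> at \<open>g\<close> and
  \<open>0\<close> elsewhere. Because \<open>g + g \<noteq> 0\<close>, the points \<open>g\<close>
  and \<open>- g\<close> differ and the values \<open>j/2\<close> and \<open>-j/2\<close> do not
  collide.\<close>

lemma PH_nonreal_exists:
  fixes g :: "'g::ab_group_add"
  assumes "g + g \<noteq> 0"
  obtains \<phi> where "\<phi> \<in> (PH :: ('g \<Rightarrow> quat) set)" "\<phi> g = (0, 1/2)"
proof -
  define b :: "'g \<Rightarrow> quat" where "b x = (if x = 0 then (1, 0) else if x = g then (0, 1) else 0)" for x
  define \<phi> :: "'g \<Rightarrow> quat" where
    "\<phi> x = (if x = 0 then (1, 0) else if x = g then (0, 1/2) else if x = - g then (0, -1/2) else 0)" for x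
  have g: "g \<noteq> 0" "- g \<noteq> 0" "- g \<noteq> g" "g + g \<noteq> g" "g + g \<noteq> 0"
    using assms by (auto simp: eq_neg_iff_add_eq_0 neg_eq_iff_add_eq_0)
  have "quat_pos_def \<phi>"
  proof (rule quat_pos_def_autocorrelation[of "1/2" "\<lambda>x. {- x, g - x}" _ b])
    fix x y :: 'g and Z :: "'g set"
    assume Z: "finite Z" "{- x, g - x} \<subseteq> Z"
    define d where "d = y - x"
    have y: "y = d + x"
      by (simp add: d_def)
    have "(\<Sum>z\<in>Z. qmult (qcnj (b (z + x))) (b (z + y)))
        = (\<Sum>z\<in>{- x, g - x}. qmult (qcnj (b (z + x))) (b (z + y)))"
    proof (rule sum.mono_neutral_right[OF Z])
      show "\<forall>z\<in>Z - {- x, g - x}. qmult (qcnj (b (z + x))) (b (z + y)) = 0"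
        by (auto simp: b_def qmult_def qcnj_def eq_neg_iff_add_eq_0 algebra_simps zero_prod_def)
    qed
    also have "\<dots> = qmult (qcnj (b 0)) (b d) + qmult (qcnj (b g)) (b (g + d))"
      using g by (subst sum.insert) (auto simp: y algebra_simps)
    also have "\<dots> = 2 *\<^sub>R \<phi> d"
    proof -
      consider "d = 0" | "d = g" | "d = - g" | "d \<noteq> 0" "d \<noteq> g" "d \<noteq> - g"
        by blast
      then show ?thesis
        by cases (use g in \<open>auto simp: b_def \<phi>_def qmult_def qcnj_def zero_prod_def
          eq_neg_iff_add_eq_0 add.commute scaleR_conv_of_real\<close>)
    qed
    finally show "\<phi> (y - x) = (1/2) *\<^sub>R (\<Sum>z\<in>Z. qmult (qcnj (b (z + x))) (b (z + y)))"
      by (simp add: d_def)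
  qed auto
  then have "\<phi> \<in> PH"
    by (simp add: PH_def \<phi>_def qone_def)
  then show thesis
    using that[of \<phi>] g by (simp add: \<phi>_def)
qed

section \<open>Rotation of the j-component\<close>

definition rot :: "complex \<Rightarrow> ('g \<Rightarrow> quat) \<Rightarrow> 'g \<Rightarrow> quat" where
  "rot c \<phi> = (\<lambda>g. (fst (\<phi> g), c * snd (\<phi> g)))"

lemma rot_rot: "rot c (rot d \<phi>) = rot (c * d) \<phi>"
  by (simp add: rot_def mult.assoc)

lemma rot_1: "rot 1 \<phi> = \<phi>"
  by (simp add: rot_def)

lemma rot_convex_combination:
  "rot c (\<lambda>g. t *\<^sub>R \<phi> g + s *\<^sub>R \<psi> g) = (\<lambda>g. t *\<^sub>R rot c \<phi> g + s *\<^sub>R rot c \<psi> g)"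
  by (simp add: rot_def fun_eq_iff algebra_simps prod_eq_iff)

text \<open>If \<open>c = u\<^sup>2\<close> with \<open>\<bar>u\<bar> = 1\<close>, then \<open>rot c\<close> is conjugation by the unit quaternion \<open>u\<close>.\<close>

lemma rot_in_PH:
  assumes "norm c = 1" "\<phi> \<in> PH"
  shows "rot c \<phi> \<in> PH"
proof -
  define u where "u = csqrt c"
  have u: "u * u = c"
    by (simp add: u_def flip: power2_eq_square)
  then have "norm u * norm u = 1"
    using assms(1) by (metis norm_mult)
  then have "norm u = 1"
    by (metis abs_norm_cancel power2_eq_1_iff power2_eq_square real_sqrt_abs real_sqrt_one)
  then have uu: "u * cnj u = 1"
    by (simp add: complex_norm_square[symmetric])
  have "quat_pos_def (rot c \<phi>)"
    unfolding quat_pos_def_def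
  proof (intro allI)
    fix k :: nat and x :: "nat \<Rightarrow> 'a" and q :: "nat \<Rightarrow> quat"
    \<comment> \<open>The conjugating unit is absorbed into the coefficients, so the form of
      \<open>rot c \<phi>\<close> is a form of \<open>\<phi>\<close> with coefficients multiplied by
      \<open>cnj u\<close> on the left.\<close>
    have conj: "qmult (qmult (qcnj p) (rot c \<phi> y)) p'
        = qmult (qmult (qcnj (qmult (cnj u, 0) p)) (\<phi> y)) (qmult (cnj u, 0) p')" for p p' y
    proof -
      have "rot c \<phi> y = qmult (qmult (u, 0) (\<phi> y)) (cnj u, 0)"
        using uu by (simp add: rot_def qmult_def flip: u)
      moreover have "qcnj (qmult (cnj u, 0) p) = qmult (qcnj p) (u, 0)"
        by (simp add: qcnj_qmult) (simp add: qcnj_def)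
      ultimately show ?thesis
        by (simp add: qmult_assoc)
    qed
    show "qnonneg_real (\<Sum>i<k. \<Sum>j<k. qmult (qmult (qcnj (q i)) (rot c \<phi> (x j - x i))) (q j))"
      using assms(2) unfolding conj by (simp add: PH_def quat_pos_def_def)
  qed
  then show ?thesis
    using assms(2) by (simp add: PH_def rot_def qone_def)
qed

text \<open>\<open>rot (cnj c)\<close> inverts \<open>rot c\<close>, preserves \<open>PH\<close> and
  commutes with convex combinations, so it carries a decomposition of \<open>rot c e\<close> back to
  one of \<open>e\<close>.\<close>

lemma rot_in_extreme_boundary:
  assumes c: "norm c = 1" and e: "e \<in> extreme_boundary PH"
  shows "rot c e \<in> extreme_boundary PH"
  unfolding extreme_boundary_def
proof (intro CollectI conjI ballI allI impI)
  show "rot c e \<in> PH"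
    using assms by (auto simp: extreme_boundary_def intro: rot_in_PH)
next
  have cc: "cnj c * c = 1" "c * cnj c = 1"
    using c by (simp_all add: complex_norm_square[symmetric] mult.commute)
  fix y z :: "'a \<Rightarrow> quat" and t :: real
  assume yz: "y \<in> PH" "z \<in> PH" and t: "0 < t \<and> t < 1 \<and> rot c e = (\<lambda>g. t *\<^sub>R y g + (1 - t) *\<^sub>R z g)"
  have "e = rot (cnj c) (rot c e)"
    by (simp add: rot_rot cc rot_1)
  also have "\<dots> = (\<lambda>g. t *\<^sub>R rot (cnj c) y g + (1 - t) *\<^sub>R rot (cnj c) z g)"
    using t by (simp add: rot_convex_combination)
  finally have mix: "e = (\<lambda>g. t *\<^sub>R rot (cnj c) y g + (1 - t) *\<^sub>R rot (cnj c) z g)" .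
  have "rot (cnj c) y \<in> PH" "rot (cnj c) z \<in> PH"
    using rot_in_PH[of "cnj c"] yz c by simp_all
  with e t mix have "rot (cnj c) y = e \<and> rot (cnj c) z = e"
    unfolding extreme_boundary_def by blast
  then show "y = rot c e" "z = rot c e"
    by (metis rot_rot cc(2) rot_1)+
qed

text \<open>The distribution of a fair coin choosing between \<open>a\<close> and \<open>b\<close>.
  It is Radon because a measurable \<open>A\<close> has the same mass as its finite, hence compact,
  subset \<open>A \<inter> {a, b}\<close>.\<close>

lemma two_point_measure_exists:
  assumes K: "closed K" "a \<in> K" "b \<in> K"
  obtains \<mu> where "radon_prob_on K \<mu>" "barycenter \<mu> (\<lambda>g. (1/2) *\<^sub>R a g + (1/2) *\<^sub>R b g)"
    "\<And>A. A \<in> sets \<mu> \<Longrightarrow> a \<notin> A \<Longrightarrow> b \<notin> A \<Longrightarrow> emeasure \<mu> A = 0"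
proof -
  define N where "N = restrict_space borel K"
  define s where "s c = (if c then a else b)" for c
  define p where "p = measure_pmf (bernoulli_pmf (1/2))"
  have spN: "space N = K" and setsN: "sets N = borel_on K"
    using K by (simp_all add: N_def space_restrict_space borel_on_closed)
  have s: "s \<in> measurable p N"
    using K by (auto simp: p_def s_def spN)
  define \<mu> where "\<mu> = distr p N s"
  have sets\<mu>: "sets \<mu> = borel_on K" "space \<mu> = K"
    by (simp_all add: \<mu>_def setsN spN)
  have em: "emeasure \<mu> A = emeasure p (s -` A)" if "A \<in> borel_on K" for A
    using that s by (simp add: \<mu>_def emeasure_distr setsN p_def)
  have cpt: "C \<in> borel_on K" if "finite C" "C \<subseteq> K" for C
    using that by (intro closed_in_borel_on[OF K(1)] compact_imp_closed_fun finite_imp_compact)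
  have radon: "radon_prob_on K \<mu>"
    unfolding radon_prob_on_def
  proof (intro conjI ballI)
    show "prob_space \<mu>"
      unfolding \<mu>_def p_def
      by (intro prob_space.prob_space_distr s[unfolded p_def]) (rule measure_pmf.prob_space_axioms)
    fix A assume A: "A \<in> sets \<mu>"
    then have AK: "A \<subseteq> K"
      using sets.sets_into_space sets\<mu>(2) by blast
    show "emeasure \<mu> A = (SUP C\<in>{C. C \<subseteq> A \<and> compactin (subtopology ptop K) C}. emeasure \<mu> C)"
    proof (rule antisym)
      have "emeasure \<mu> A = emeasure \<mu> (A \<inter> {a, b})"
      proof -
        have "s -` A = s -` (A \<inter> {a, b})"
          by (auto simp: s_def split: if_splits)
        then show ?thesis
          using A AK cpt[of "A \<inter> {a, b}"] em by (simp add: sets\<mu> le_infI1)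
      qed
      also have "\<dots> \<le> (SUP C\<in>{C. C \<subseteq> A \<and> compactin (subtopology ptop K) C}. emeasure \<mu> C)"
        using AK by (intro SUP_upper)
          (auto simp: compactin_subtopology ptop_eq_euclidean intro!: finite_imp_compact)
      finally show "emeasure \<mu> A \<le> (SUP C\<in>{C. C \<subseteq> A \<and> compactin (subtopology ptop K) C}. emeasure \<mu> C)" .
      show "(SUP C\<in>{C. C \<subseteq> A \<and> compactin (subtopology ptop K) C}. emeasure \<mu> C) \<le> emeasure \<mu> A"
        using A by (intro SUP_least emeasure_mono) auto
    qed
  qed (use sets\<mu> in auto)
  have bary: "barycenter \<mu> (\<lambda>g. (1/2) *\<^sub>R a g + (1/2) *\<^sub>R b g)"
    unfolding barycenter_def
  proof (intro allI impI)
    fix f :: "('a \<Rightarrow> quat) \<Rightarrow> real" assume f: "cont_lin_functional f"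
    have meas: "f \<in> borel_measurable N"
      unfolding N_def
      by (intro measurable_restrict_space1 cont_lin_functional_borel_measurable f)
    have int: "integrable \<mu> f"
      unfolding \<mu>_def using integrable_distr_eq[OF s meas]
      by (simp add: p_def integrable_measure_pmf_finite)
    have "(\<integral>y. f y \<partial>\<mu>) = (\<integral>c. f (s c) \<partial>p)"
      unfolding \<mu>_def by (rule integral_distr[OF s meas])
    also have "\<dots> = 1/2 * f a + 1/2 * f b"
      by (simp add: p_def s_def)
    also have "\<dots> = f (\<lambda>g. (1/2) *\<^sub>R a g + (1/2) *\<^sub>R b g)"
      using f unfolding cont_lin_functional_def by metis
    finally show "integrable \<mu> f \<and> f (\<lambda>g. (1/2) *\<^sub>R a g + (1/2) *\<^sub>R b g) = (\<integral>y. f y \<partial>\<mu>)"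
      using int by simp
  qed
  show thesis
  proof (rule that[OF radon bary])
    fix A assume "A \<in> sets \<mu>" "a \<notin> A" "b \<notin> A"
    moreover from this have "s -` A = {}"
      by (auto simp: s_def split: if_splits)
    ultimately show "emeasure \<mu> A = 0"
      by (simp add: em sets\<mu>)
  qed
qed

lemma bauer_simplex_imp_exponent_two:
  assumes bauer: "bauer_simplex (PH :: ('g::ab_group_add \<Rightarrow> quat) set)"
  shows "g + g = (0::'g)"
proof (rule ccontr)
  assume "g + g \<noteq> 0"
  then obtain \<phi> where \<phi>: "\<phi> \<in> (PH :: ('g \<Rightarrow> quat) set)" "\<phi> g = (0, 1/2)"
    by (rule PH_nonreal_exists)
  let ?K = "PH :: ('g \<Rightarrow> quat) set"
  let ?E = "extreme_boundary ?K"
  have cl: "closed ?K" "closed ?E"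
    using bauer by (auto simp: bauer_simplex_def ptop_eq_euclidean intro: compact_imp_closed_fun)
  have KE: "?K - ?E \<in> borel_on ?K"
    using cl by (auto simp: borel_on_closed sets_restrict_space)
  have uniq: "\<mu> = \<nu>"
    if "radon_prob_on ?K \<mu>" "emeasure \<mu> (?K - ?E) = 0" "barycenter \<mu> x"
       "radon_prob_on ?K \<nu>" "emeasure \<nu> (?K - ?E) = 0" "barycenter \<nu> x" "x \<in> ?K" for \<mu> \<nu> x
    using bauer that unfolding bauer_simplex_def by blast
  \<comment> \<open>If the \<open>j\<close>-component at \<open>g\<close> vanished on all extreme
    points, it would integrate to \<open>0\<close> against a representing measure of
    \<open>\<phi>\<close>, whereas its value at \<open>\<phi>\<close> is \<open>1/2\<close>.\<close>
  have "\<exists>e\<in>?E. snd (e g) \<noteq> 0"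
  proof (rule ccontr)
    assume "\<not> (\<exists>e\<in>?E. snd (e g) \<noteq> 0)"
    then have E: "\<And>e. e \<in> ?E \<Longrightarrow> snd (e g) = 0"
      by auto
    obtain \<mu> where \<mu>: "radon_prob_on ?K \<mu>" "emeasure \<mu> (?K - ?E) = 0" "barycenter \<mu> \<phi>"
      using bauer \<phi> unfolding bauer_simplex_def by blast
    have "bounded_linear (\<lambda>q::quat. Re (snd q))"
      by (intro bounded_linear_compose[OF bounded_linear_Re] bounded_linear_snd)
    then have "cont_lin_functional (\<lambda>\<psi> :: 'g \<Rightarrow> quat. Re (snd (\<psi> g)))"
      by (rule cont_lin_functional_coordinate)
    then have "Re (snd (\<phi> g)) = (\<integral>\<psi>. Re (snd (\<psi> g)) \<partial>\<mu>)"
      using \<mu>(3) by (simp add: barycenter_def)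
    also have "\<dots> = 0"
    proof (rule integral_eq_zero_AE)
      have "AE \<psi> in \<mu>. \<psi> \<in> ?E"
        using \<mu>(1,2) KE by (intro AE_I[of _ _ "?K - ?E"]) (auto simp: radon_prob_on_def)
      then show "AE \<psi> in \<mu>. Re (snd (\<psi> g)) = 0"
        by eventually_elim (simp add: E)
    qed
    finally show False
      using \<phi> by simp
  qed
  then obtain e where e: "e \<in> ?E" "snd (e g) \<noteq> 0"
    by auto
  have rotE: "rot c e \<in> ?E" "rot c e \<in> ?K" if "norm c = 1" for c
    using rot_in_extreme_boundary[OF that e(1)] by (auto simp: extreme_boundary_def)
  have dist: "rot c e \<noteq> rot d e" if "c \<noteq> d" for c d
    using that e(2) by (auto simp: rot_def dest!: fun_cong[of _ _ g])
  \<comment> \<open>The midpoint does not depend on \<open>c\<close>, so \<open>c = 1\<close> and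
    \<open>c = \<i>\<close> give two representations of the same point.\<close>
  define x where "x = rot 0 e"
  have mid: "(\<lambda>h. (1/2) *\<^sub>R rot c e h + (1/2) *\<^sub>R rot (- c) e h) = x" for c
    by (simp add: x_def rot_def fun_eq_iff prod_eq_iff scaleR_conv_of_real)
  obtain \<mu> where \<mu>: "radon_prob_on ?K \<mu>" "barycenter \<mu> x"
    "\<And>A. A \<in> sets \<mu> \<Longrightarrow> rot 1 e \<notin> A \<Longrightarrow> rot (- 1) e \<notin> A \<Longrightarrow> emeasure \<mu> A = 0"
    using two_point_measure_exists[OF cl(1) rotE(2)[of 1] rotE(2)[of "- 1"]] mid[of 1] by auto
  obtain \<nu> where \<nu>: "radon_prob_on ?K \<nu>" "barycenter \<nu> x"
    "\<And>A. A \<in> sets \<nu> \<Longrightarrow> rot \<i> e \<notin> A \<Longrightarrow> rot (- \<i>) e \<notin> A \<Longrightarrow> emeasure \<nu> A = 0"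
    using two_point_measure_exists[OF cl(1) rotE(2)[of \<i>] rotE(2)[of "- \<i>"]] mid[of \<i>] by auto
  have sets: "sets \<mu> = borel_on ?K" "sets \<nu> = borel_on ?K" "space \<mu> = ?K" "prob_space \<mu>"
    using \<mu>(1) \<nu>(1) by (auto simp: radon_prob_on_def)
  have "fconvex ?K"
    using bauer by (simp add: bauer_simplex_def)
  then have "(\<lambda>h. (1/2) *\<^sub>R rot 1 e h + (1 - 1/2) *\<^sub>R rot (- 1) e h) \<in> ?K"
    unfolding fconvex_def by (elim ballE allE[of _ "1/2"]) (auto simp: rotE)
  then have "x \<in> ?K"
    using mid[of 1] by simp
  moreover have "emeasure \<mu> (?K - ?E) = 0" "emeasure \<nu> (?K - ?E) = 0"
    using \<mu>(3)[of "?K - ?E"] \<nu>(3)[of "?K - ?E"] KE rotE(1) by (auto simp: sets)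
  ultimately have eq: "\<mu> = \<nu>"
    using uniq \<mu> \<nu> by blast
  \<comment> \<open>\<open>\<mu>\<close> is concentrated on this pair, while \<open>\<nu>\<close>
    gives it no mass; equality of the two leaves total mass \<open>0\<close>.\<close>
  let ?A = "{rot 1 e, rot (- 1) e}"
  have A: "?A \<in> borel_on ?K"
    using rotE(2)
    by (intro closed_in_borel_on[OF cl(1)] compact_imp_closed_fun finite_imp_compact) auto
  have "emeasure \<mu> ?A = 0"
    using \<nu>(3)[of ?A] A dist by (simp add: eq sets complex_eq_iff)
  moreover have "emeasure \<mu> (?K - ?A) = 0"
    using \<mu>(3)[of "?K - ?A"] A sets by (metis DiffE insert_iff sets.compl_sets)
  moreover have "emeasure \<mu> ?K \<le> emeasure \<mu> ?A + emeasure \<mu> (?K - ?A)"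
  proof -
    have "?A \<union> (?K - ?A) = ?K"
      using rotE(2) by auto
    then show ?thesis
      using emeasure_subadditive[of ?A \<mu> "?K - ?A"] A sets by (metis sets.compl_sets)
  qed
  ultimately show False
    using prob_space.emeasure_space_1[OF sets(4)] sets(3) by simp
qed

section \<open>Positive definite functions and sign patterns\<close>

text \<open>Testing with real coefficients does not force \<open>r\<close> to be even; evenness is
  therefore a separate hypothesis in \<open>quat_pos_def_of_real\<close>.\<close>

definition real_pos_def :: "('g::ab_group_add \<Rightarrow> real) \<Rightarrow> bool" where
  "real_pos_def r \<longleftrightarrow>
     (\<forall>(k::nat) (x::nat \<Rightarrow> 'g) (c::nat \<Rightarrow> real). 0 \<le> (\<Sum>i<k. \<Sum>j<k. c i * c j * r (x j - x i)))"

lemma real_pos_def_finite: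
  assumes "real_pos_def r" "finite I"
  shows "0 \<le> (\<Sum>i\<in>I. \<Sum>j\<in>I. c i * c j * r (x j - x i))"
proof -
  obtain b where b: "bij_betw b {..<card I} I"
    using ex_bij_betw_nat_finite[OF assms(2)] by (auto simp: atLeast0LessThan)
  have "(\<Sum>i\<in>I. \<Sum>j\<in>I. c i * c j * r (x j - x i))
      = (\<Sum>i<card I. \<Sum>j<card I. c (b i) * c (b j) * r (x (b j) - x (b i)))"
    by (simp add: sum.reindex_bij_betw[OF b, symmetric])
  then show ?thesis
    using assms(1)[unfolded real_pos_def_def, rule_format, of "\<lambda>i. c (b i)" "\<lambda>i. x (b i)" "card I"]
    by simp
qed

definition re_part :: "('g \<Rightarrow> quat) \<Rightarrow> 'g \<Rightarrow> real" where
  "re_part \<phi> g = Re (fst (\<phi> g))"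

lemma qmult_real_kernel:
  assumes "snd a = 0" "Im (fst a) = 0"
  shows "qmult (qmult (qcnj p) a) q = Re (fst a) *\<^sub>R qmult (qcnj p) q"
proof -
  define t where "t = Re (fst a)"
  have "a = (complex_of_real t, 0)"
    using assms by (simp add: t_def prod_eq_iff complex_eq_iff)
  then show ?thesis
    by (simp add: qmult_def prod_eq_iff scaleR_conv_of_real algebra_simps)
qed

lemma antisymmetric_sum_zero:
  fixes f :: "nat \<Rightarrow> nat \<Rightarrow> 'a::real_vector"
  assumes "\<And>i j. f j i = - f i j"
  shows "(\<Sum>i<k. \<Sum>j<k. f i j) = 0"
proof -
  have "(\<Sum>i<k. \<Sum>j<k. f i j) = (\<Sum>i<k. \<Sum>j<k. f j i)"
    by (rule sum.swap)
  also have "\<dots> = - (\<Sum>i<k. \<Sum>j<k. f i j)"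
    unfolding sum_negf[symmetric] by (intro sum.cong refl assms)
  finally have "(\<Sum>i<k. \<Sum>j<k. f i j) + (\<Sum>i<k. \<Sum>j<k. f i j) = 0"
    by (simp add: eq_neg_iff_add_eq_0)
  then have "2 *\<^sub>R (\<Sum>i<k. \<Sum>j<k. f i j) = 0"
    by (simp add: scaleR_2)
  then show ?thesis
    by simp
qed

text \<open>The imaginary components of \<open>qmult (qcnj (q i)) (q j)\<close> are antisymmetric in
  \<open>i\<close> and \<open>j\<close> and cancel against the symmetric kernel. The real part
  splits into four real quadratic forms, one for each component of the coefficients.\<close>

lemma quat_pos_def_of_real:
  fixes \<phi> :: "'g::ab_group_add \<Rightarrow> quat"
  assumes real: "\<And>g. snd (\<phi> g) = 0" "\<And>g. Im (fst (\<phi> g)) = 0"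
    and pd: "real_pos_def (re_part \<phi>)" and even: "\<And>g. re_part \<phi> (- g) = re_part \<phi> g"
  shows "quat_pos_def \<phi>"
  unfolding quat_pos_def_def
proof (intro allI)
  fix k :: nat and x :: "nat \<Rightarrow> 'g" and q :: "nat \<Rightarrow> quat"
  define R where "R i j = re_part \<phi> (x j - x i)" for i j
  have symm: "R j i = R i j" for i j
    using even[of "x i - x j"] by (simp add: R_def)
  have pos: "0 \<le> (\<Sum>i<k. \<Sum>j<k. c i * c j * R i j)" for c :: "nat \<Rightarrow> real"
    using pd by (simp add: real_pos_def_def R_def)
  let ?P = "\<lambda>i j. R i j *\<^sub>R qmult (qcnj (q i)) (q j)"
  have eq: "(\<Sum>i<k. \<Sum>j<k. qmult (qmult (qcnj (q i)) (\<phi> (x j - x i))) (q j)) = (\<Sum>i<k. \<Sum>j<k. ?P i j)"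
    by (simp add: qmult_real_kernel real R_def re_part_def)
  have "Im (fst (\<Sum>i<k. \<Sum>j<k. ?P i j)) = (\<Sum>i<k. \<Sum>j<k. Im (fst (?P i j)))"
    by (simp add: fst_sum)
  also have "\<dots> = 0"
    by (rule antisymmetric_sum_zero) (simp add: symm qmult_def qcnj_def algebra_simps)
  finally have "Im (fst (\<Sum>i<k. \<Sum>j<k. ?P i j)) = 0" .
  moreover have "snd (\<Sum>i<k. \<Sum>j<k. ?P i j) = (\<Sum>i<k. \<Sum>j<k. snd (?P i j))"
    by (simp add: snd_sum)
  moreover have "\<dots> = 0"
    by (rule antisymmetric_sum_zero) (simp add: symm qmult_def qcnj_def algebra_simps)
  moreover have "Re (fst (\<Sum>i<k. \<Sum>j<k. ?P i j))
     = (\<Sum>i<k. \<Sum>j<k. Re (fst (q i)) * Re (fst (q j)) * R i j)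
     + (\<Sum>i<k. \<Sum>j<k. Im (fst (q i)) * Im (fst (q j)) * R i j)
     + (\<Sum>i<k. \<Sum>j<k. Re (snd (q i)) * Re (snd (q j)) * R i j)
     + (\<Sum>i<k. \<Sum>j<k. Im (snd (q i)) * Im (snd (q j)) * R i j)"
    by (simp add: fst_sum qmult_def qcnj_def algebra_simps flip: sum.distrib)
  ultimately show "qnonneg_real (\<Sum>i<k. \<Sum>j<k. qmult (qmult (qcnj (q i)) (\<phi> (x j - x i))) (q j))"
    unfolding eq qnonneg_real_def
    using pos[of "\<lambda>i. Re (fst (q i))"] pos[of "\<lambda>i. Im (fst (q i))"]
      pos[of "\<lambda>i. Re (snd (q i))"] pos[of "\<lambda>i. Im (snd (q i))"] by simp
qed

section \<open>Sign-pattern pieces of a function\<close>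

definition pattern_sign :: "'g set \<Rightarrow> 'g \<Rightarrow> real" where
  "pattern_sign S g = (if g \<in> S then 1 else - 1)"

lemma pattern_sign_square: "pattern_sign S g * pattern_sign S g = 1"
  by (simp add: pattern_sign_def)

text \<open>The product over \<open>g \<in> F\<close> of the operators (identity +
  \<open>pattern_sign S g\<close> times translation by \<open>g\<close>) / 2, applied to
  \<open>r\<close> and expanded over the subsets \<open>T\<close> of \<open>F\<close>. In exponent
  two these operators are commuting projections, and the value at \<open>0\<close> is the weight of
  the pattern.\<close>

definition pattern_mass :: "('g::ab_group_add \<Rightarrow> real) \<Rightarrow> 'g set \<Rightarrow> 'g set \<Rightarrow> 'g \<Rightarrow> real" where
  "pattern_mass r F S x = (\<Sum>T\<in>Pow F. (\<Prod>g\<in>T. pattern_sign S g) * r (x + \<Sum>T)) / 2 ^ card F"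

lemma pattern_mass_empty: "pattern_mass r {} S x = r x"
  by (simp add: pattern_mass_def)

text \<open>Sorting the subsets of \<open>insert h F\<close> by whether they contain
  \<open>h\<close> peels off one factor of the product; the inductions over \<open>F\<close> rest on
  this recursion.\<close>

lemma pattern_mass_insert:
  assumes "finite F" "h \<notin> F"
  shows "pattern_mass r (insert h F) S x
    = (pattern_mass r F S x + pattern_sign S h * pattern_mass r F S (x + h)) / 2"
proof -
  let ?t = "\<lambda>x T. (\<Prod>g\<in>T. pattern_sign S g) * r (x + \<Sum>T)"
  have T: "finite T" "h \<notin> T" if "T \<in> Pow F" for T
    using that assms finite_subset by auto
  have "(\<Sum>T\<in>Pow (insert h F). ?t x T) = (\<Sum>T\<in>Pow F. ?t x T) + (\<Sum>T\<in>insert h ` Pow F. ?t x T)"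
    unfolding Pow_insert by (rule sum.union_disjoint) (use assms in auto)
  also have "(\<Sum>T\<in>insert h ` Pow F. ?t x T) = (\<Sum>T\<in>Pow F. ?t x (insert h T))"
  proof (rule sum.reindex_cong[OF _ refl refl])
    show "inj_on (insert h) (Pow F)"
      by (rule inj_onI) (metis PowD assms(2) insert_ident subsetD)
  qed
  also have "\<dots> = (\<Sum>T\<in>Pow F. pattern_sign S h * ?t (x + h) T)"
    using T by (intro sum.cong refl) (simp add: algebra_simps)
  finally show ?thesis
    using assms by (simp add: pattern_mass_def sum_distrib_left[symmetric] add_divide_distrib)
qed

lemma pattern_mass_cong:
  assumes "\<And>g. g \<in> F \<Longrightarrow> g \<in> S \<longleftrightarrow> g \<in> S'"
  shows "pattern_mass r F S x = pattern_mass r F S' x"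
  unfolding pattern_mass_def
  using assms by (intro arg_cong2[of _ _ _ _ "(/)"] sum.cong refl arg_cong2[of _ _ _ _ "(*)"] prod.cong)
    (auto simp: pattern_sign_def)

text \<open>The factor for \<open>h\<close> multiplies a character by
  \<open>(1 + pattern_sign S h * s h) / 2\<close>, which is \<open>1\<close> if the signs agree and
  \<open>0\<close> otherwise.\<close>

lemma pattern_mass_character:
  assumes "finite F" and hom: "\<And>x y. s (x + y) = s x * s y" and sq: "\<And>x. s x * s x = (1::real)"
  shows "pattern_mass s F S x = (if \<forall>g\<in>F. s g = pattern_sign S g then s x else 0)"
  using assms(1)
proof (induction F arbitrary: x rule: finite_induct)
  case empty
  show ?case by (simp add: pattern_mass_empty)
next
  case (insert h F)
  have "s h = 1 \<or> s h = - 1"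
    using sq[of h] by (simp add: square_eq_1_iff)
  then show ?case
    using insert by (auto simp: pattern_mass_insert hom pattern_sign_def)
qed

section \<open>Positive definiteness in groups of exponent two\<close>

locale exponent_two_group =
  fixes G :: "'g::ab_group_add itself"
  assumes exponent_two: "g + g = (0::'g)"
begin

lemma minus_eq_self: "- g = (g::'g)"
  using exponent_two[of g] by (simp add: neg_eq_iff_add_eq_0)

lemma diff_eq_add: "x - y = x + (y::'g)"
  using minus_eq_self[of y] by (metis diff_conv_add_uminus)

lemma add_cancel_self: "x + g + g = (x::'g)"
  by (simp add: add.assoc exponent_two)

text \<open>A doubling argument: the form of \<open>r\<close> is evaluated at the points
  \<open>x i\<close> and \<open>x i + h\<close> with coefficients \<open>c i\<close> and
  \<open>c i * e\<close>. Since \<open>- h = h\<close> and \<open>e * e = 1\<close>, the four terms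
  for each pair combine to four times the desired one.\<close>

lemma real_pos_def_half_shift:
  fixes r :: "'g \<Rightarrow> real"
  assumes "real_pos_def r" and e: "e * e = 1"
  shows "real_pos_def (\<lambda>x. (r x + e * r (x + h)) / 2)"
  unfolding real_pos_def_def
proof (intro allI)
  fix k :: nat and x :: "nat \<Rightarrow> 'g" and c :: "nat \<Rightarrow> real"
  define c' where "c' = (\<lambda>(i, b). c i * (if b then e else 1))"
  define x' where "x' = (\<lambda>(i, b). x i + (if b then h else 0))"
  have "0 \<le> (\<Sum>p\<in>{..<k} \<times> UNIV. \<Sum>q\<in>{..<k} \<times> UNIV. c' p * c' q * r (x' q - x' p))"
    by (intro real_pos_def_finite assms) simp
  also have "\<dots> = (\<Sum>i<k. \<Sum>b\<in>UNIV. \<Sum>j<k. \<Sum>b'\<in>UNIV. c' (i, b) * c' (j, b') * r (x' (j, b') - x' (i, b)))"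
    by (simp add: sum.cartesian_product')
  also have "\<dots> = (\<Sum>i<k. \<Sum>j<k. c i * c j * (2 * (r (x j + x i) + e * r (x j + x i + h))))"
  proof (intro sum.cong refl)
    fix i
    have "(\<Sum>b\<in>UNIV. \<Sum>j<k. \<Sum>b'\<in>UNIV. c' (i, b) * c' (j, b') * r (x' (j, b') - x' (i, b)))
      = (\<Sum>j<k. \<Sum>b\<in>UNIV. \<Sum>b'\<in>UNIV. c' (i, b) * c' (j, b') * r (x' (j, b') - x' (i, b)))"
      by (rule sum.swap)
    also have "\<dots> = (\<Sum>j<k. c i * c j * (2 * (r (x j + x i) + e * r (x j + x i + h))))"
    proof (intro sum.cong refl)
      fix j
      have "r (x j + h - x i) = r (x j + x i + h)" "r (x j - (x i + h)) = r (x j + x i + h)"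
        "r (x j - x i) = r (x j + x i)"
        by (simp_all add: diff_eq_add ac_simps)
      moreover have "e = 1 \<or> e = - 1"
        using e by (simp add: square_eq_1_iff)
      ultimately show "(\<Sum>b\<in>UNIV. \<Sum>b'\<in>UNIV. c' (i, b) * c' (j, b') * r (x' (j, b') - x' (i, b)))
          = c i * c j * (2 * (r (x j + x i) + e * r (x j + x i + h)))"
        by (auto simp: UNIV_bool c'_def x'_def distrib_left)
    qed
    finally show "(\<Sum>b\<in>UNIV. \<Sum>j<k. \<Sum>b'\<in>UNIV. c' (i, b) * c' (j, b') * r (x' (j, b') - x' (i, b)))
      = (\<Sum>j<k. c i * c j * (2 * (r (x j + x i) + e * r (x j + x i + h))))" .
  qed
  also have "\<dots> = 4 * (\<Sum>i<k. \<Sum>j<k. c i * c j * ((r (x j - x i) + e * r (x j - x i + h)) / 2))"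
    unfolding sum_distrib_left by (intro sum.cong refl) (simp add: diff_eq_add)
  finally show "0 \<le> (\<Sum>i<k. \<Sum>j<k. c i * c j * ((r (x j - x i) + e * r (x j - x i + h)) / 2))"
    by simp
qed

lemma real_pos_def_pattern_mass:
  fixes r :: "'g \<Rightarrow> real"
  assumes "real_pos_def r" "finite F"
  shows "real_pos_def (pattern_mass r F S)"
  using assms(2)
proof (induction F rule: finite_induct)
  case empty
  have "pattern_mass r {} S = r"
    by (rule ext) (rule pattern_mass_empty)
  with assms show ?case by simp
next
  case (insert h F)
  then have "pattern_mass r (insert h F) S
      = (\<lambda>x. (pattern_mass r F S x + pattern_sign S h * pattern_mass r F S (x + h)) / 2)"
    by (intro ext pattern_mass_insert)
  with insert show ?case
    by (simp add: real_pos_def_half_shift pattern_sign_square)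
qed

text \<open>The factor for \<open>g\<close> projects onto the eigenspace of translation by
  \<open>g\<close> with eigenvalue \<open>pattern_sign S g\<close>, because
  \<open>g + g = 0\<close>; the other factors commute with this translation.\<close>

lemma pattern_mass_shift:
  fixes r :: "'g \<Rightarrow> real"
  assumes "finite F" "g \<in> F"
  shows "pattern_mass r F S (x + g) = pattern_sign S g * pattern_mass r F S x"
  using assms
proof (induction F arbitrary: x rule: finite_induct)
  case (insert h F)
  show ?case
  proof (cases "g = h")
    case True
    then show ?thesis
      using insert.hyps by (simp add: pattern_mass_insert add_cancel_self pattern_sign_def)
  next
    case False
    then have g: "g \<in> F"
      using insert.prems by simp
    have "pattern_mass r F S (x + g + h) = pattern_mass r F S (x + h + g)"
      by (simp add: ac_simps)
    then show ?thesis
      using insert.hyps by (simp add: pattern_mass_insert insert.IH[OF g] distrib_left)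
  qed
qed simp

text \<open>The form is tested at \<open>0\<close> and \<open>g\<close> with coefficients
  \<open>1\<close> and \<open>e = \<plusminus>1\<close>; the two mixed terms agree since
  \<open>- g = g\<close>.\<close>

lemma real_pos_def_abs_le:
  fixes r :: "'g \<Rightarrow> real"
  assumes "real_pos_def r"
  shows "\<bar>r g\<bar> \<le> r 0"
proof -
  have "0 \<le> 2 * (r 0 + e * r g)" if "e * e = 1" for e
  proof -
    have "0 \<le> (\<Sum>p\<in>UNIV. \<Sum>q\<in>UNIV. (if p then e else 1) * (if q then e else 1)
        * r ((if q then g else 0) - (if p then g else 0)))"
      by (rule real_pos_def_finite[OF assms]) simp
    also have "\<dots> = 2 * (r 0 + e * r g)"
      using that by (simp add: UNIV_bool minus_eq_self)
    finally show ?thesis .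
  qed
  from this[of 1] this[of "- 1"] show ?thesis
    by simp
qed

lemma real_pos_def_nonneg_at_0: "real_pos_def (r :: 'g \<Rightarrow> real) \<Longrightarrow> 0 \<le> r 0"
  using real_pos_def_abs_le[of r 0] by simp

text \<open>Testing at \<open>0\<close> and \<open>g\<close> with both coefficients \<open>1\<close>
  shows that \<open>2 + 2 \<phi>(g)\<close> is real, as \<open>- g = g\<close>. For the converse the
  same identity supplies the evenness asked for by \<open>quat_pos_def_of_real\<close>.\<close>

lemma PH_iff:
  fixes \<phi> :: "'g \<Rightarrow> quat"
  shows "\<phi> \<in> PH \<longleftrightarrow> (\<forall>g. snd (\<phi> g) = 0) \<and> (\<forall>g. Im (fst (\<phi> g)) = 0)
    \<and> real_pos_def (re_part \<phi>) \<and> re_part \<phi> 0 = 1"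
proof
  assume "\<phi> \<in> PH"
  then have pd: "quat_pos_def \<phi>" and one: "\<phi> 0 = qone"
    by (simp_all add: PH_def)
  have real: "snd (\<phi> g) = 0 \<and> Im (fst (\<phi> g)) = 0" for g
  proof -
    have "qnonneg_real (\<Sum>i<2::nat. \<Sum>j<2::nat. qmult (qmult (qcnj qone)
        (\<phi> ((if j = 0 then 0 else g) - (if i = 0 then 0 else g)))) qone)"
      using pd[unfolded quat_pos_def_def, rule_format, of "\<lambda>_. qone" "\<lambda>i. if i = 0 then 0 else g" 2]
      by simp
    then show ?thesis
      using one by (auto simp: numeral_2_eq_2 qmult_def qcnj_def qone_def qnonneg_real_def minus_eq_self)
  qed
  moreover have "real_pos_def (re_part \<phi>)"
    unfolding real_pos_def_def
  proof (intro allI)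
    fix k :: nat and x :: "nat \<Rightarrow> 'g" and c :: "nat \<Rightarrow> real"
    have "0 \<le> Re (fst (\<Sum>i<k. \<Sum>j<k. qmult (qmult (qcnj (complex_of_real (c i), 0))
        (\<phi> (x j - x i))) (complex_of_real (c j), 0)))"
      using pd by (simp add: quat_pos_def_def qnonneg_real_def)
    also have "\<dots> = (\<Sum>i<k. \<Sum>j<k. c i * c j * re_part \<phi> (x j - x i))"
      by (simp add: fst_sum qmult_real_kernel real) (simp add: re_part_def qmult_def qcnj_def algebra_simps)
    finally show "0 \<le> (\<Sum>i<k. \<Sum>j<k. c i * c j * re_part \<phi> (x j - x i))" .
  qed
  ultimately show "(\<forall>g. snd (\<phi> g) = 0) \<and> (\<forall>g. Im (fst (\<phi> g)) = 0)
    \<and> real_pos_def (re_part \<phi>) \<and> re_part \<phi> 0 = 1"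
    using one by (simp add: re_part_def qone_def)
next
  assume "(\<forall>g. snd (\<phi> g) = 0) \<and> (\<forall>g. Im (fst (\<phi> g)) = 0)
    \<and> real_pos_def (re_part \<phi>) \<and> re_part \<phi> 0 = 1"
  then show "\<phi> \<in> PH"
    using quat_pos_def_of_real[of \<phi>]
    by (auto simp: PH_def qone_def minus_eq_self prod_eq_iff complex_eq_iff re_part_def)
qed

end

section \<open>Characters as extreme points\<close>

text \<open>Continuity forces a linear functional to vanish on all functions vanishing on some finite set.\<close>

lemma cont_lin_functional_finite_support:
  fixes f :: "('g \<Rightarrow> quat) \<Rightarrow> real"
  assumes "cont_lin_functional f"
  obtains F where "finite F" "\<And>x. (\<And>g. g \<in> F \<Longrightarrow> x g = 0) \<Longrightarrow> f x = 0"
proof -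
  have scale: "f (\<lambda>g. c *\<^sub>R x g) = c * f x" for c x
    using assms by (simp add: cont_lin_functional_def)
  have "open (f -` {-1<..<1})"
    using assms by (intro open_vimage) (auto simp: cont_lin_functional_def ptop_eq_euclidean)
  moreover have "(\<lambda>_. 0) \<in> f -` {-1<..<1}"
    using scale[of 0 "\<lambda>_. 0"] by simp
  ultimately obtain X where X: "(\<lambda>_. 0) \<in> Pi\<^sub>E UNIV X" "finite {i. X i \<noteq> UNIV}"
      "Pi\<^sub>E UNIV X \<subseteq> f -` {-1<..<1}"
    using product_topology_open_contains_basis[of "\<lambda>_. euclidean" UNIV "f -` {-1<..<1}" "\<lambda>_. 0"]
    by (auto simp: open_fun_def)
  show thesis
  proof (rule that[OF X(2)])
    fix x :: "'g \<Rightarrow> quat" assume x: "\<And>g. g \<in> {i. X i \<noteq> UNIV} \<Longrightarrow> x g = 0"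
    show "f x = 0"
    proof (rule ccontr)
      assume "f x \<noteq> 0"
      \<comment> \<open>All multiples of \<open>x\<close> stay in the basic neighbourhood because
        \<open>x\<close> vanishes at its restricted coordinates; the factor \<open>1 / f x\<close>
        would give \<open>f\<close> the value \<open>1\<close>, outside the interval.\<close>
      have "(\<lambda>g. (1 / f x) *\<^sub>R x g) \<in> Pi\<^sub>E UNIV X"
        using x X(1) by (auto simp: PiE_iff) (metis UNIV_I scaleR_zero_right)
      then have "f (\<lambda>g. (1 / f x) *\<^sub>R x g) \<in> {-1<..<1}"
        using X(3) by blast
      with \<open>f x \<noteq> 0\<close> show False
        unfolding scale by simp
    qed
  qed
qed

text \<open>Reduces barycenter identities for real-valued functions to finitely many coordinates:
  finite support leaves a finite sum, whose coefficients are the values of \<open>f\<close> on the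
  functions \<open>unit g\<close>.\<close>

lemma cont_lin_functional_real_valued:
  fixes f :: "('g \<Rightarrow> quat) \<Rightarrow> real"
  assumes f: "cont_lin_functional f"
  obtains F a where "finite F"
    "\<And>x. (\<And>g. snd (x g) = 0) \<Longrightarrow> (\<And>g. Im (fst (x g)) = 0) \<Longrightarrow> f x = (\<Sum>g\<in>F. a g * re_part x g)"
proof -
  obtain F where F: "finite F" "\<And>x. (\<And>g. g \<in> F \<Longrightarrow> x g = 0) \<Longrightarrow> f x = 0"
    using cont_lin_functional_finite_support[OF f] by blast
  have scale: "f (\<lambda>g. c *\<^sub>R x g) = c * f x" and add: "f (\<lambda>g. x g + y g) = f x + f y" for c x y
    using f by (simp_all add: cont_lin_functional_def)
  define unit where "unit g = (\<lambda>h. if h = g then qone else 0)" for g :: 'g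
  show thesis
  proof (rule that[OF F(1)])
    fix x :: "'g \<Rightarrow> quat" assume x: "\<And>g. snd (x g) = 0" "\<And>g. Im (fst (x g)) = 0"
    have "f (\<lambda>h. if h \<in> H then x h else 0) = (\<Sum>g\<in>H. f (unit g) * re_part x g)" if "finite H" for H
      using that
    proof (induction H rule: finite_induct)
      case empty
      show ?case using F(2)[of "\<lambda>_. 0"] by simp
    next
      case (insert g H)
      have "(\<lambda>h. if h \<in> insert g H then x h else 0)
          = (\<lambda>h. (if h \<in> H then x h else 0) + re_part x g *\<^sub>R unit g h)"
        using insert.hyps x
        by (auto simp: fun_eq_iff unit_def qone_def re_part_def prod_eq_iff complex_eq_iff)
      then show ?case
        using insert by (simp add: add scale)
    qed
    note this[OF F(1)]
    moreover have "f x = f (\<lambda>h. if h \<in> F then x h else 0)"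
    proof -
      have "f (\<lambda>h. (if h \<in> F then x h else 0) + (if h \<in> F then 0 else x h)) = f (\<lambda>h. if h \<in> F then x h else 0)"
        unfolding add using F(2)[of "\<lambda>h. if h \<in> F then 0 else x h"] by simp
      moreover have "(\<lambda>h. (if h \<in> F then x h else 0) + (if h \<in> F then 0 else x h)) = x"
        by auto
      ultimately show ?thesis by simp
    qed
    ultimately show "f x = (\<Sum>g\<in>F. f (unit g) * re_part x g)"
      by simp
  qed
qed

lemma continuous_on_re_part: "continuous_on UNIV (\<lambda>\<phi>. re_part \<phi> g)"
  unfolding re_part_def by (intro continuous_intros continuous_on_product_coordinates)

lemma cont_lin_functional_pattern_mass:
  assumes "finite F"
  shows "cont_lin_functional (\<lambda>\<phi>. pattern_mass (re_part \<phi>) F S x)"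
proof -
  have "continuous_on UNIV (\<lambda>\<phi>. pattern_mass (re_part \<phi>) F S x)"
    unfolding pattern_mass_def by (intro continuous_intros continuous_on_re_part) simp
  then show ?thesis
    by (simp add: cont_lin_functional_def ptop_eq_euclidean pattern_mass_def re_part_def
        distrib_left sum.distrib add_divide_distrib sum_distrib_left mult.left_commute)
qed

section \<open>Characters and their sign patterns\<close>

text \<open>Homomorphisms to \<open>{1, -1}\<close>, phrased by equations between continuous
  coordinates so that closedness is immediate; the equation for squares excludes the zero
  function.\<close>

definition characters :: "('g::ab_group_add \<Rightarrow> quat) set" where
  "characters = {\<xi>. \<forall>x y. snd (\<xi> x) = 0 \<and> Im (fst (\<xi> x)) = 0 \<and>
     re_part \<xi> (x + y) = re_part \<xi> x * re_part \<xi> y \<and> re_part \<xi> x * re_part \<xi> x = 1}"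

lemma closed_characters: "closed characters"
  unfolding characters_def
  by (intro closed_Collect_all closed_Collect_conj closed_Collect_eq continuous_intros
      continuous_on_re_part continuous_on_product_coordinates)

text \<open>Carries the Boolean cube, where the measure is built, into the space containing
  \<open>PH\<close>.\<close>

definition sign_function :: "('g \<Rightarrow> bool) \<Rightarrow> 'g \<Rightarrow> quat" where
  "sign_function b g = (if b g then 1 else - 1, 0)"

lemma re_part_sign_function: "re_part (sign_function b) g = (if b g then 1 else - 1)"
  by (simp add: re_part_def sign_function_def)

lemma continuous_on_sign_function: "continuous_on UNIV sign_function"
proof (rule continuous_on_coordinatewise_then_product)
  fix g :: 'a
  have "continuous_on UNIV ((\<lambda>c. (if c then 1 else - 1, 0) :: quat) \<circ> (\<lambda>b::'a \<Rightarrow> bool. b g))"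
    by (intro continuous_on_compose continuous_on_product_coordinates)
      (auto intro: continuous_on_subset[OF continuous_on_discrete])
  then show "continuous_on UNIV (\<lambda>b. sign_function b g)"
    by (simp add: sign_function_def comp_def)
qed

lemma character_eq_sign_function:
  assumes "\<xi> \<in> characters"
  shows "\<xi> = sign_function (\<lambda>g. re_part \<xi> g = 1)"
proof
  fix g
  have "re_part \<xi> g = 1 \<or> re_part \<xi> g = - 1" "snd (\<xi> g) = 0" "Im (fst (\<xi> g)) = 0"
    using assms by (auto simp: characters_def square_eq_1_iff)
  then show "\<xi> g = sign_function (\<lambda>g. re_part \<xi> g = 1) g"
    by (auto simp: sign_function_def re_part_def prod_eq_iff complex_eq_iff)
qed

text \<open>On characters a continuous linear functional coincides with an indicator function; this
  is why the barycenter determines the masses of pattern sets.\<close>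

lemma pattern_mass_of_character:
  assumes "\<xi> \<in> characters" "finite F"
  shows "pattern_mass (re_part \<xi>) F S 0 = indicator {\<xi>. \<forall>g\<in>F. re_part \<xi> g = pattern_sign S g} \<xi>"
proof -
  have "re_part \<xi> 0 = re_part \<xi> 0 * re_part \<xi> 0" "re_part \<xi> 0 * re_part \<xi> 0 = 1"
    using assms(1) unfolding characters_def by (metis (mono_tags, lifting) add.left_neutral mem_Collect_eq)+
  then have "re_part \<xi> 0 = 1"
    by simp
  then show ?thesis
    using assms by (subst pattern_mass_character) (auto simp: characters_def indicator_def)
qed

section \<open>Compactness, convexity and extreme points in exponent two\<close>

context exponent_two_group
begin

lemma closed_PH: "closed (PH :: ('g \<Rightarrow> quat) set)"
proof -
  have "PH = {\<phi> :: 'g \<Rightarrow> quat. (\<forall>g. snd (\<phi> g) = 0) \<and> (\<forall>g. Im (fst (\<phi> g)) = 0) \<and>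
    (\<forall>(k::nat) x c. 0 \<le> (\<Sum>i<k. \<Sum>j<k. c i * c j * re_part \<phi> (x j - x i))) \<and> re_part \<phi> 0 = 1}"
    by (auto simp: PH_iff real_pos_def_def)
  also have "closed \<dots>"
    by (intro closed_Collect_all closed_Collect_conj closed_Collect_eq closed_Collect_le
        continuous_intros continuous_on_re_part continuous_on_product_coordinates)
  finally show ?thesis .
qed

lemma compact_PH: "compact (PH :: ('g \<Rightarrow> quat) set)"
proof -
  let ?B = "cball (0::complex) 1 \<times> {0::complex}"
  have "compact ?B"
    by (intro compact_Times) auto
  then have "compactin (product_topology (\<lambda>_::'g. euclidean) UNIV) (Pi\<^sub>E UNIV (\<lambda>_. ?B))"
    by (simp add: compactin_PiE)
  then have box: "compact (Pi\<^sub>E UNIV (\<lambda>_::'g. ?B))"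
    by (simp add: euclidean_product_topology)
  have "(PH :: ('g \<Rightarrow> quat) set) \<subseteq> Pi\<^sub>E UNIV (\<lambda>_. ?B)"
  proof
    fix \<phi> :: "'g \<Rightarrow> quat" assume \<phi>: "\<phi> \<in> PH"
    have "\<phi> g \<in> ?B" for g
    proof -
      have "\<bar>re_part \<phi> g\<bar> \<le> 1"
        using \<phi> real_pos_def_abs_le[of "re_part \<phi>" g] by (simp add: PH_iff)
      moreover have "snd (\<phi> g) = 0" "Im (fst (\<phi> g)) = 0"
        using \<phi> by (simp_all add: PH_iff)
      ultimately show ?thesis
        by (cases "\<phi> g") (simp add: re_part_def cmod_eq_Re)
    qed
    then show "\<phi> \<in> Pi\<^sub>E UNIV (\<lambda>_. ?B)"
      by (simp add: PiE_iff)
  qed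
  then show ?thesis
    using compact_Int_closed[OF box closed_PH] by (simp add: inf.absorb2)
qed

lemma fconvex_PH: "fconvex (PH :: ('g \<Rightarrow> quat) set)"
  unfolding fconvex_def
proof (intro ballI allI impI)
  fix \<phi> \<psi> :: "'g \<Rightarrow> quat" and t :: real
  assume \<phi>: "\<phi> \<in> PH" and \<psi>: "\<psi> \<in> PH" and t: "0 \<le> t \<and> t \<le> 1"
  have re: "re_part (\<lambda>g. t *\<^sub>R \<phi> g + (1 - t) *\<^sub>R \<psi> g) g = t * re_part \<phi> g + (1 - t) * re_part \<psi> g" for g
    by (simp add: re_part_def)
  have "real_pos_def (re_part (\<lambda>g. t *\<^sub>R \<phi> g + (1 - t) *\<^sub>R \<psi> g))"
    unfolding real_pos_def_def
  proof (intro allI)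
    fix k :: nat and x :: "nat \<Rightarrow> 'g" and c :: "nat \<Rightarrow> real"
    have "(\<Sum>i<k. \<Sum>j<k. c i * c j * re_part (\<lambda>g. t *\<^sub>R \<phi> g + (1 - t) *\<^sub>R \<psi> g) (x j - x i))
        = t * (\<Sum>i<k. \<Sum>j<k. c i * c j * re_part \<phi> (x j - x i))
        + (1 - t) * (\<Sum>i<k. \<Sum>j<k. c i * c j * re_part \<psi> (x j - x i))"
      by (simp add: re sum_distrib_left sum.distrib[symmetric] distrib_left mult.left_commute)
    also have "\<dots> \<ge> 0"
      using \<phi> \<psi> t by (intro add_nonneg_nonneg mult_nonneg_nonneg) (auto simp: PH_iff real_pos_def_def)
    finally show "0 \<le> (\<Sum>i<k. \<Sum>j<k. c i * c j * re_part (\<lambda>g. t *\<^sub>R \<phi> g + (1 - t) *\<^sub>R \<psi> g) (x j - x i))" .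
  qed
  then show "(\<lambda>g. t *\<^sub>R \<phi> g + (1 - t) *\<^sub>R \<psi> g) \<in> PH"
    using \<phi> \<psi> by (simp add: PH_iff) (simp add: re_part_def)
qed

text \<open>As \<open>x - y = x + y\<close>, the quadratic form of a character is the square of a
  single sum.\<close>

lemma characters_subset_PH: "(characters :: ('g \<Rightarrow> quat) set) \<subseteq> PH"
proof
  fix \<xi> :: "'g \<Rightarrow> quat" assume \<xi>: "\<xi> \<in> characters"
  then have hom: "re_part \<xi> (x + y) = re_part \<xi> x * re_part \<xi> y"
    and sq: "re_part \<xi> x * re_part \<xi> x = 1" for x y
    by (auto simp: characters_def)
  have "real_pos_def (re_part \<xi>)"
    unfolding real_pos_def_def
  proof (intro allI)
    fix k :: nat and x :: "nat \<Rightarrow> 'g" and c :: "nat \<Rightarrow> real"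
    have "(\<Sum>i<k. \<Sum>j<k. c i * c j * re_part \<xi> (x j - x i))
        = (\<Sum>i<k. c i * re_part \<xi> (x i)) * (\<Sum>j<k. c j * re_part \<xi> (x j))"
      by (simp add: sum_product diff_eq_add hom ac_simps)
    then show "0 \<le> (\<Sum>i<k. \<Sum>j<k. c i * c j * re_part \<xi> (x j - x i))"
      by simp
  qed
  moreover have "re_part \<xi> 0 = 1"
    using hom[of 0 0] sq[of 0] by simp
  ultimately show "\<xi> \<in> PH"
    using \<xi> by (simp add: PH_iff characters_def)
qed

lemma real_pos_def_scale:
  assumes "real_pos_def (r :: 'g \<Rightarrow> real)" "0 \<le> c"
  shows "real_pos_def (\<lambda>x. c * r x)"
  unfolding real_pos_def_def
proof (intro allI)
  fix k :: nat and x :: "nat \<Rightarrow> 'g" and d :: "nat \<Rightarrow> real"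
  have "(\<Sum>i<k. \<Sum>j<k. d i * d j * (c * r (x j - x i))) = c * (\<Sum>i<k. \<Sum>j<k. d i * d j * r (x j - x i))"
    by (simp add: sum_distrib_left ac_simps)
  with assms show "0 \<le> (\<Sum>i<k. \<Sum>j<k. d i * d j * (c * r (x j - x i)))"
    by (simp add: real_pos_def_def)
qed

text \<open>An extreme point \<open>r\<close> is proportional to both summands of
  \<open>r = (r + r(\<cdot> + g)) / 2 + (r - r(\<cdot> + g)) / 2\<close>.\<close>

lemma extreme_point_multiplicative:
  fixes e :: "'g \<Rightarrow> quat"
  assumes e: "e \<in> extreme_boundary PH"
  shows "re_part e (x + g) = re_part e x * re_part e g"
proof -
  let ?r = "re_part e"
  have ePH: "e \<in> PH"
    using e by (simp add: extreme_boundary_def)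
  then have pd: "real_pos_def ?r" and r0: "?r 0 = 1"
    by (simp_all add: PH_iff)
  define p where "p = (\<lambda>s x. (?r x + s * ?r (x + g)) / 2)"
  have pdp: "real_pos_def (p 1)" "real_pos_def (p (- 1))"
    unfolding p_def by (rule real_pos_def_half_shift[OF pd]; simp)+
  have p0: "p s 0 = (1 + s * ?r g) / 2" for s
    by (simp add: p_def r0)
  define t where "t = p 1 0"
  have t1: "p (- 1) 0 = 1 - t"
    by (simp add: t_def p0 field_simps)
  have p1t: "p 1 x = t * ?r x" for x
  proof -
    \<comment> \<open>Normalising the two summands divides by \<open>t\<close> and
      \<open>1 - t\<close>. In the degenerate cases one summand vanishes at \<open>0\<close>, hence
      everywhere by \<open>real_pos_def_abs_le\<close>.\<close>
    consider "t = 0" | "t = 1" | "0 < t" "t < 1"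
      using real_pos_def_nonneg_at_0[OF pdp(1)] real_pos_def_nonneg_at_0[OF pdp(2)] t1
      by (fold t_def) linarith
    then show ?thesis
    proof cases
      case 1
      then show ?thesis
        using real_pos_def_abs_le[OF pdp(1), of x] by (simp add: t_def)
    next
      case 2
      then have "p (- 1) x = 0"
        using real_pos_def_abs_le[OF pdp(2), of x] t1 by simp
      then show ?thesis
        using 2 by (simp add: p_def field_simps)
    next
      case 3
      define y where "y = (\<lambda>x. (complex_of_real ((1 / t) * p 1 x), 0 :: complex))"
      define z where "z = (\<lambda>x. (complex_of_real ((1 / (1 - t)) * p (- 1) x), 0 :: complex))"
      have re: "re_part y = (\<lambda>x. (1 / t) * p 1 x)" "re_part z = (\<lambda>x. (1 / (1 - t)) * p (- 1) x)"
        by (simp_all add: re_part_def y_def z_def fun_eq_iff)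
      have "real_pos_def (re_part y)" "real_pos_def (re_part z)"
        unfolding re by (intro real_pos_def_scale pdp; use 3 in simp)+
      then have "y \<in> PH" "z \<in> PH"
        unfolding PH_iff using 3 t1 by (auto simp: re) (auto simp: y_def z_def t_def[symmetric])
      moreover have "e = (\<lambda>g. t *\<^sub>R y g + (1 - t) *\<^sub>R z g)"
      proof
        fix h
        have "e h = (complex_of_real (?r h), 0)"
          using ePH by (simp add: PH_iff re_part_def prod_eq_iff complex_eq_iff)
        moreover have "?r h = p 1 h + p (- 1) h"
          by (simp add: p_def field_simps)
        ultimately show "e h = t *\<^sub>R y h + (1 - t) *\<^sub>R z h"
          using 3 by (simp add: y_def z_def scaleR_conv_of_real)
      qed
      ultimately have "y = e"
        using e 3 unfolding extreme_boundary_def by blast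
      then have "?r x = (1 / t) * p 1 x"
        using fun_cong[OF re(1), of x] by simp
      then show ?thesis
        using 3 by simp
    qed
  qed
  have "?r x + ?r (x + g) = (1 + ?r g) * ?r x"
    using p1t[of x] by (simp add: p_def t_def r0 field_simps)
  then show ?thesis
    by (simp add: algebra_simps)
qed

text \<open>Extreme points are multiplicative, and their values have square \<open>1\<close> since
  \<open>x + x = 0\<close>. Conversely, characters take values at the ends of the interval
  \<open>[-1, 1]\<close> containing all values of members of \<open>PH\<close>, so a proper convex
  combination is trivial in each coordinate.\<close>

lemma extreme_boundary_PH: "extreme_boundary (PH :: ('g \<Rightarrow> quat) set) = characters"
proof (intro equalityI subsetI)
  fix e :: "'g \<Rightarrow> quat" assume e: "e \<in> extreme_boundary PH"
  then have ePH: "e \<in> PH"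
    by (simp add: extreme_boundary_def)
  have "re_part e x * re_part e x = 1" for x
    using extreme_point_multiplicative[OF e, of x x] ePH by (simp add: exponent_two PH_iff)
  then show "e \<in> characters"
    using extreme_point_multiplicative[OF e] ePH by (simp add: characters_def PH_iff)
next
  fix \<xi> :: "'g \<Rightarrow> quat" assume \<xi>: "\<xi> \<in> characters"
  show "\<xi> \<in> extreme_boundary PH"
    unfolding extreme_boundary_def
  proof (intro CollectI conjI ballI allI impI)
    show "\<xi> \<in> PH"
      using \<xi> characters_subset_PH by blast
  next
    fix y z :: "'g \<Rightarrow> quat" and t :: real
    assume y: "y \<in> PH" and z: "z \<in> PH"
      and t: "0 < t \<and> t < 1 \<and> \<xi> = (\<lambda>g. t *\<^sub>R y g + (1 - t) *\<^sub>R z g)"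
    have "y g = \<xi> g \<and> z g = \<xi> g" for g
    proof -
      have b: "\<bar>re_part y g\<bar> \<le> 1" "\<bar>re_part z g\<bar> \<le> 1"
        using y z real_pos_def_abs_le[of "re_part y" g] real_pos_def_abs_le[of "re_part z" g]
        by (simp_all add: PH_iff)
      have mix: "re_part \<xi> g = t * re_part y g + (1 - t) * re_part z g"
        using t by (simp add: re_part_def)
      have strict: "a = 1 \<and> b = 1" if "t * a + (1 - t) * b = 1" "a \<le> 1" "b \<le> 1" for a b :: real
      proof -
        have "t * (1 - a) + (1 - t) * (1 - b) = 0"
          using that(1) by (simp add: algebra_simps)
        moreover have "0 \<le> t * (1 - a)" "0 \<le> (1 - t) * (1 - b)"
          using that t by auto
        ultimately have "t * (1 - a) = 0" "(1 - t) * (1 - b) = 0"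
          by linarith+
        with t show ?thesis by auto
      qed
      have "re_part \<xi> g = 1 \<or> re_part \<xi> g = - 1"
        using \<xi> by (auto simp: characters_def square_eq_1_iff)
      then have "re_part y g = re_part \<xi> g \<and> re_part z g = re_part \<xi> g"
      proof
        assume "re_part \<xi> g = 1"
        with strict[of "re_part y g" "re_part z g"] b mix show ?thesis by auto
      next
        assume "re_part \<xi> g = - 1"
        with strict[of "- re_part y g" "- re_part z g"] b mix show ?thesis by auto
      qed
      then show ?thesis
        using y z \<xi> by (simp add: PH_iff characters_def re_part_def prod_eq_iff complex_eq_iff)
    qed
    then show "y = \<xi>" "z = \<xi>"
      by auto
  qed
qed

section \<open>Representing measures in exponent two\<close>

lemma compactin_PH_iff:
  "compactin (subtopology ptop (PH :: ('g \<Rightarrow> quat) set)) C \<longleftrightarrow> compact C \<and> C \<subseteq> PH"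
  by (auto simp: compactin_subtopology ptop_eq_euclidean)

lemma radon_prob_on_PH_closed_sets:
  assumes "radon_prob_on (PH :: ('g \<Rightarrow> quat) set) \<mu>" "closed C" "C \<subseteq> PH"
  shows "C \<in> sets \<mu>"
  using assms closed_in_borel_on[OF closed_PH] by (simp add: radon_prob_on_def)

lemma AE_characters:
  fixes \<mu> :: "('g \<Rightarrow> quat) measure"
  assumes \<mu>: "radon_prob_on PH \<mu>" "emeasure \<mu> (PH - characters) = 0"
  shows "AE \<xi> in \<mu>. \<xi> \<in> characters"
proof (rule AE_I)
  have sp: "space \<mu> = PH"
    using \<mu>(1) by (simp add: radon_prob_on_def)
  show "PH - characters \<in> sets \<mu>"
    using sets.compl_sets[OF radon_prob_on_PH_closed_sets[OF \<mu>(1) closed_characters characters_subset_PH]]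
    by (simp add: sp)
  show "{\<xi> \<in> space \<mu>. \<xi> \<notin> characters} \<subseteq> PH - characters"
    by (auto simp: sp)
qed (rule \<mu>(2))

definition pattern_characters :: "'g set \<Rightarrow> 'g set \<Rightarrow> ('g \<Rightarrow> quat) set" where
  "pattern_characters F S = {\<xi> \<in> characters. \<forall>g\<in>F. re_part \<xi> g = pattern_sign S g}"

lemma closed_pattern_characters: "closed (pattern_characters F S)"
proof -
  have "closed (characters \<inter> {\<xi>. \<forall>g. g \<in> F \<longrightarrow> re_part \<xi> g = pattern_sign S g})"
    by (intro closed_Int closed_characters closed_Collect_all closed_Collect_imp
        closed_Collect_eq continuous_intros continuous_on_re_part) auto
  also have "characters \<inter> {\<xi>. \<forall>g. g \<in> F \<longrightarrow> re_part \<xi> g = pattern_sign S g} = pattern_characters F S"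
    by (auto simp: pattern_characters_def)
  finally show ?thesis .
qed

text \<open>The functional \<open>pattern_mass\<close> at \<open>0\<close> is integrated against
  \<open>\<mu>\<close>; almost everywhere it is the indicator of the pattern set.\<close>

lemma measure_pattern_characters:
  fixes \<mu> :: "('g \<Rightarrow> quat) measure"
  assumes \<mu>: "radon_prob_on PH \<mu>" "emeasure \<mu> (PH - characters) = 0" "barycenter \<mu> x"
    and F: "finite F"
  shows "measure \<mu> (pattern_characters F S) = pattern_mass (re_part x) F S 0"
proof -
  have sub: "pattern_characters F S \<subseteq> PH"
    using characters_subset_PH by (auto simp: pattern_characters_def)
  have sets: "pattern_characters F S \<in> sets \<mu>"
    by (rule radon_prob_on_PH_closed_sets[OF \<mu>(1) closed_pattern_characters sub])
  have ae: "AE \<xi> in \<mu>. pattern_mass (re_part \<xi>) F S 0 = indicator (pattern_characters F S) \<xi>"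
    using AE_characters[OF \<mu>(1,2)] by eventually_elim
      (use F in \<open>auto simp: pattern_mass_of_character pattern_characters_def indicator_def\<close>)
  have fl: "cont_lin_functional (\<lambda>\<xi>::'g \<Rightarrow> quat. pattern_mass (re_part \<xi>) F S 0)"
    by (rule cont_lin_functional_pattern_mass[OF F])
  then have int: "integrable \<mu> (\<lambda>\<xi>. pattern_mass (re_part \<xi>) F S 0)"
    using \<mu>(3) by (simp add: barycenter_def)
  have "pattern_mass (re_part x) F S 0 = (\<integral>\<xi>. pattern_mass (re_part \<xi>) F S 0 \<partial>\<mu>)"
    using \<mu>(3) fl by (simp add: barycenter_def)
  also have "\<dots> = (\<integral>\<xi>. indicator (pattern_characters F S) \<xi> \<partial>\<mu>)"
    using borel_measurable_integrable[OF int] sets by (intro integral_cong_AE ae) auto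
  also have "\<dots> = measure \<mu> (pattern_characters F S)"
    using sets sets.sets_into_space by (simp add: inf.absorb2)
  finally show ?thesis by simp
qed

text \<open>A closed set of characters and a closed set disjoint from it are separated by
  a finite union of pattern sets, whose measure is determined by the barycenter.\<close>

lemma representing_measure_le:
  fixes \<mu> \<nu> :: "('g \<Rightarrow> quat) measure"
  assumes \<mu>: "radon_prob_on PH \<mu>" "emeasure \<mu> (PH - characters) = 0" "barycenter \<mu> x"
    and \<nu>: "radon_prob_on PH \<nu>" "emeasure \<nu> (PH - characters) = 0" "barycenter \<nu> x"
    and C: "closed C" "C \<subseteq> characters"
  shows "emeasure \<mu> C \<le> emeasure \<nu> C"
proof (rule ennreal_le_epsilon)
  fix \<epsilon> :: real assume \<epsilon>: "0 < \<epsilon>"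
  interpret M: prob_space \<mu> using \<mu>(1) by (simp add: radon_prob_on_def)
  interpret N: prob_space \<nu> using \<nu>(1) by (simp add: radon_prob_on_def)
  have sp: "space \<nu> = PH"
    using \<nu>(1) by (simp add: radon_prob_on_def)
  have CPH: "C \<subseteq> PH"
    using C characters_subset_PH by blast
  have setC: "C \<in> sets \<mu>" "C \<in> sets \<nu>"
    using radon_prob_on_PH_closed_sets C(1) CPH \<mu>(1) \<nu>(1) by blast+
  have compl: "PH - C \<in> sets \<nu>"
    using sets.compl_sets[OF setC(2)] by (simp add: sp)
  have "emeasure \<nu> (PH - C) \<le> (SUP D\<in>{D. D \<subseteq> PH - C \<and> compact D}. emeasure \<nu> D)"
  proof -
    have "emeasure \<nu> (PH - C) = (SUP D\<in>{D. D \<subseteq> PH - C \<and> compactin (subtopology ptop PH) D}. emeasure \<nu> D)"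
      using \<nu>(1) compl by (simp add: radon_prob_on_def)
    also have "\<dots> \<le> (SUP D\<in>{D. D \<subseteq> PH - C \<and> compact D}. emeasure \<nu> D)"
      by (rule SUP_subset_mono) (auto simp: compactin_PH_iff)
    finally show ?thesis .
  qed
  moreover have "{D. D \<subseteq> PH - C \<and> compact D} \<noteq> {}"
    by (auto intro: exI[of _ "{}"])
  \<comment> \<open>By inner regularity a compact \<open>D\<close> disjoint from \<open>C\<close>
    carries all but \<open>\<epsilon>\<close> of the mass outside \<open>C\<close>, so a set
    avoiding \<open>D\<close> has at most \<open>\<epsilon>\<close> more mass than
    \<open>C\<close>.\<close>
  ultimately obtain D where D: "D \<subseteq> PH - C" "compact D" "emeasure \<nu> (PH - C) < emeasure \<nu> D + \<epsilon>"
  proof -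
    assume le: "emeasure \<nu> (PH - C) \<le> (SUP D\<in>{D. D \<subseteq> PH - C \<and> compact D}. emeasure \<nu> D)"
      and ne: "{D. D \<subseteq> PH - C \<and> compact D} \<noteq> {}"
    have "(SUP D\<in>{D. D \<subseteq> PH - C \<and> compact D}. emeasure \<nu> D)
        < (SUP D\<in>{D. D \<subseteq> PH - C \<and> compact D}. emeasure \<nu> D + ennreal \<epsilon>)"
    proof -
      have "(SUP D\<in>{D. D \<subseteq> PH - C \<and> compact D}. emeasure \<nu> D) \<le> 1"
        by (intro SUP_least N.emeasure_le_1)
      then have "(SUP D\<in>{D. D \<subseteq> PH - C \<and> compact D}. emeasure \<nu> D) \<noteq> top"
        using neq_top_trans by force
      then show ?thesis
        using \<epsilon> by (subst ennreal_SUP_add_left[OF ne]) simp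
    qed
    with le have "emeasure \<nu> (PH - C) < (SUP D\<in>{D. D \<subseteq> PH - C \<and> compact D}. emeasure \<nu> D + ennreal \<epsilon>)"
      by (rule order_le_less_trans)
    then show thesis
      using that by (auto simp: less_SUP_iff)
  qed
  have clD: "closed D"
    by (rule compact_imp_closed_fun[OF D(2)])
  have setD: "D \<in> sets \<nu>"
    using radon_prob_on_PH_closed_sets[OF \<nu>(1) clD] D(1) by blast
  \<comment> \<open>The separation takes place in the Boolean cube: as \<open>C\<close> and
    \<open>D\<close> are disjoint, these two open preimages cover it, and over a large enough base
    each cylinder lies in one of them.\<close>
  let ?W = "sign_function -` (- D)" and ?C = "sign_function -` C"
  have "closed ?C" "open ?W"
    using continuous_on_sign_function C(1) clD
    by (auto intro!: closed_vimage open_vimage simp: open_closed)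
  moreover have "UNIV \<subseteq> \<Union>{?W, - ?C}"
    using D(1) by auto
  ultimately obtain F :: "'g set" where F: "finite F"
      "\<And>S. cyl F S \<subseteq> ?W \<or> cyl F S \<subseteq> - ?C"
    using closed_cover_cyl_refinement[of UNIV "{}" "{?W, - ?C}"] by auto
  \<comment> \<open>The patterns whose cylinders avoid \<open>D\<close>; a pattern realised by a
    point of \<open>C\<close> is among them, because its cylinder cannot lie in
    \<open>- ?C\<close>.\<close>
  define P where "P = {S. S \<subseteq> F \<and> cyl F S \<subseteq> ?W}"
  have finP: "finite P"
    unfolding P_def by (rule finite_subset[of _ "Pow F"]) (use F(1) in auto)
  let ?Q = "pattern_characters F"
  have Q_PH: "?Q S \<subseteq> PH" for S
    using characters_subset_PH by (auto simp: pattern_characters_def)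
  have setQ: "?Q S \<in> sets \<mu>" "?Q S \<in> sets \<nu>" for S
    using radon_prob_on_PH_closed_sets[OF \<mu>(1) closed_pattern_characters Q_PH]
      radon_prob_on_PH_closed_sets[OF \<nu>(1) closed_pattern_characters Q_PH] by auto
  have Q_cyl: "(\<lambda>g. re_part \<xi> g = 1) \<in> cyl F S" if "\<xi> \<in> ?Q S" for \<xi> S
    using that by (auto simp: pattern_characters_def cyl_def pattern_sign_def)
  have cover: "C \<subseteq> (\<Union>S\<in>P. ?Q S)"
  proof
    fix \<xi> assume \<xi>: "\<xi> \<in> C"
    then have ch: "\<xi> \<in> characters"
      using C(2) by blast
    define S where "S = {g\<in>F. re_part \<xi> g = 1}"
    have "re_part \<xi> g = 1 \<or> re_part \<xi> g = - 1" for g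
      using ch by (auto simp: characters_def square_eq_1_iff)
    then have Q: "\<xi> \<in> ?Q S"
      using ch by (auto simp: pattern_characters_def S_def pattern_sign_def)
    have "(\<lambda>g. re_part \<xi> g = 1) \<in> ?C"
      using \<xi> character_eq_sign_function[OF ch] by simp
    then have "S \<in> P"
      using F(2)[of S] Q_cyl[OF Q] by (auto simp: P_def S_def)
    with Q show "\<xi> \<in> (\<Union>S\<in>P. ?Q S)"
      by blast
  qed
  have avoid: "(\<Union>S\<in>P. ?Q S) \<subseteq> PH - D"
  proof
    fix \<xi> assume "\<xi> \<in> (\<Union>S\<in>P. ?Q S)"
    then obtain S where S: "S \<in> P" "\<xi> \<in> ?Q S"
      by blast
    then have ch: "\<xi> \<in> characters"
      by (simp add: pattern_characters_def)
    have "(\<lambda>g. re_part \<xi> g = 1) \<in> ?W"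
      using S Q_cyl[of \<xi> S] by (auto simp: P_def)
    then show "\<xi> \<in> PH - D"
      using character_eq_sign_function[OF ch] ch characters_subset_PH by auto
  qed
  have disj: "disjoint_family_on ?Q P"
  proof (unfold disjoint_family_on_def, intro ballI impI)
    fix S S' assume S: "S \<in> P" "S' \<in> P" "S \<noteq> S'"
    then obtain g where "g \<in> F" "(g \<in> S) \<noteq> (g \<in> S')"
      by (auto simp: P_def)
    then have "g \<in> F" "pattern_sign S g \<noteq> pattern_sign S' g"
      by (auto simp: pattern_sign_def)
    then show "?Q S \<inter> ?Q S' = {}"
      by (auto simp: pattern_characters_def)
  qed
  have "measure \<mu> C \<le> measure \<mu> (\<Union>S\<in>P. ?Q S)"
    using cover setQ finP by (intro M.finite_measure_mono) auto
  also have "\<dots> = (\<Sum>S\<in>P. measure \<mu> (?Q S))"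
    by (rule M.finite_measure_finite_Union[OF finP _ disj]) (use setQ in auto)
  also have "\<dots> = (\<Sum>S\<in>P. measure \<nu> (?Q S))"
    using measure_pattern_characters[OF \<mu> F(1)] measure_pattern_characters[OF \<nu> F(1)] by simp
  also have "\<dots> = measure \<nu> (\<Union>S\<in>P. ?Q S)"
    by (rule N.finite_measure_finite_Union[OF finP _ disj, symmetric]) (use setQ in auto)
  also have "\<dots> \<le> measure \<nu> (PH - D)"
    using avoid setD sp sets.compl_sets[OF setD] by (intro N.finite_measure_mono) auto
  also have "\<dots> = 1 - measure \<nu> D"
    using N.prob_compl[OF setD] sp by simp
  also have "\<dots> \<le> measure \<nu> C + \<epsilon>"
  proof -
    have "measure \<nu> (PH - C) < measure \<nu> D + \<epsilon>"
      using D(3) \<epsilon> by (simp add: N.emeasure_eq_measure ennreal_less_iff flip: ennreal_plus)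
    moreover have "measure \<nu> (PH - C) = 1 - measure \<nu> C"
      using N.prob_compl[OF setC(2)] sp by simp
    ultimately show ?thesis by simp
  qed
  finally show "emeasure \<mu> C \<le> emeasure \<nu> C + ennreal \<epsilon>"
    using \<epsilon> by (simp add: M.emeasure_eq_measure N.emeasure_eq_measure flip: ennreal_plus)
qed

text \<open>Two applications of \<open>representing_measure_le\<close> give equality on closed sets
  of characters. The rest of \<open>PH\<close> is null, and inner regularity passes from closed sets
  to all measurable ones.\<close>

lemma representing_measure_unique:
  fixes \<mu> \<nu> :: "('g \<Rightarrow> quat) measure"
  assumes \<mu>: "radon_prob_on PH \<mu>" "emeasure \<mu> (PH - characters) = 0" "barycenter \<mu> x"
    and \<nu>: "radon_prob_on PH \<nu>" "emeasure \<nu> (PH - characters) = 0" "barycenter \<nu> x"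
  shows "\<mu> = \<nu>"
proof (rule measure_eqI)
  show sets: "sets \<mu> = sets \<nu>"
    using \<mu>(1) \<nu>(1) by (simp add: radon_prob_on_def)
  have concentrated: "emeasure \<kappa> C = emeasure \<kappa> (C \<inter> characters)"
    if \<kappa>: "radon_prob_on PH \<kappa>" "emeasure \<kappa> (PH - characters) = 0" and C: "closed C" "C \<subseteq> PH"
    for \<kappa> :: "('g \<Rightarrow> quat) measure" and C
  proof (rule emeasure_eq_AE)
    have setX: "characters \<in> sets \<kappa>" and setC: "C \<in> sets \<kappa>"
      using radon_prob_on_PH_closed_sets[OF \<kappa>(1)] closed_characters characters_subset_PH C by auto
    show "AE \<xi> in \<kappa>. \<xi> \<in> C \<longleftrightarrow> \<xi> \<in> C \<inter> characters"
      using AE_characters[OF \<kappa>] by eventually_elim auto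
    show "C \<in> sets \<kappa>" "C \<inter> characters \<in> sets \<kappa>"
      using setC setX by auto
  qed
  have closed_eq: "emeasure \<mu> C = emeasure \<nu> C" if C: "closed C" "C \<subseteq> PH" for C
    unfolding concentrated[OF \<mu>(1,2) C] concentrated[OF \<nu>(1,2) C]
    using C closed_characters
    by (intro antisym representing_measure_le[OF \<mu> \<nu>] representing_measure_le[OF \<nu> \<mu>]) auto
  fix A assume A: "A \<in> sets \<mu>"
  have "emeasure \<mu> A = (SUP C\<in>{C. C \<subseteq> A \<and> compactin (subtopology ptop PH) C}. emeasure \<mu> C)"
    using \<mu>(1) A by (simp add: radon_prob_on_def)
  also have "\<dots> = (SUP C\<in>{C. C \<subseteq> A \<and> compactin (subtopology ptop PH) C}. emeasure \<nu> C)"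
    by (intro SUP_cong refl closed_eq) (auto simp: compactin_PH_iff compact_imp_closed_fun)
  also have "\<dots> = emeasure \<nu> A"
    using \<nu>(1) A sets by (simp add: radon_prob_on_def)
  finally show "emeasure \<mu> A = emeasure \<nu> A" .
qed

section \<open>Existence of the representing measure\<close>

text \<open>With \<open>True\<close> for \<open>1\<close> and \<open>False\<close> for
  \<open>-1\<close>, equivalence of truth values is multiplication of signs.\<close>

definition bool_characters :: "('g \<Rightarrow> bool) set" where
  "bool_characters = {b. \<forall>g h. b (g + h) \<longleftrightarrow> (b g \<longleftrightarrow> b h)}"

lemma sign_function_in_characters_iff: "sign_function b \<in> characters \<longleftrightarrow> b \<in> bool_characters"
proof -
  have "sign_function b \<in> characters \<longleftrightarrow> (\<forall>g h. re_part (sign_function b) (g + h)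
      = re_part (sign_function b) g * re_part (sign_function b) h)"
  proof -
    have "re_part (sign_function b) g * re_part (sign_function b) g = 1"
      "snd (sign_function b g) = 0" "Im (fst (sign_function b g)) = 0" for g
      by (simp_all add: re_part_sign_function sign_function_def)
    then show ?thesis
      unfolding characters_def mem_Collect_eq by blast
  qed
  also have "\<dots> \<longleftrightarrow> (\<forall>g h. b (g + h) \<longleftrightarrow> (b g \<longleftrightarrow> b h))"
    unfolding re_part_sign_function by (intro all_cong1) (simp split: if_split)
  finally show ?thesis
    by (simp add: bool_characters_def)
qed

lemma closed_bool_characters: "closed bool_characters"
proof -
  have eq: "bool_characters = sign_function -` characters"
    by (auto simp: sign_function_in_characters_iff)
  show ?thesis
    unfolding eq by (rule closed_vimage[OF closed_characters continuous_on_sign_function])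
qed

text \<open>Weights are values at \<open>0\<close> of positive definite pieces, hence nonnegative;
  \<open>split\<close> holds because the two factors for \<open>h\<close> with opposite signs add up
  to the identity.\<close>

lemma cylinder_content_pattern_mass:
  fixes r :: "'g \<Rightarrow> real"
  assumes r: "real_pos_def r" "r 0 = 1"
  shows "cylinder_content (\<lambda>F S. pattern_mass r F S 0)"
proof
  fix F S :: "'g set" and h
  show "0 \<le> pattern_mass r F S 0" if "finite F"
    using real_pos_def_nonneg_at_0[OF real_pos_def_pattern_mass[OF r(1) that]] .
  assume F: "finite F" "h \<notin> F" "S \<subseteq> F"
  have "pattern_mass r F (insert h S) x = pattern_mass r F S x" for x
    using F by (intro pattern_mass_cong) auto
  moreover have "h \<notin> S"
    using F by auto
  ultimately show "pattern_mass r F S 0 = pattern_mass r (insert h F) S 0 + pattern_mass r (insert h F) (insert h S) 0"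
    using F by (simp add: pattern_mass_insert pattern_sign_def field_simps)
next
  show "pattern_mass r {} {} 0 = 1"
    by (simp add: pattern_mass_empty r)
qed

text \<open>Translation by \<open>g + h\<close>, performed at once or in two steps, multiplies the
  piece by two different signs, so its value at \<open>0\<close> vanishes.\<close>

lemma pattern_mass_inconsistent:
  fixes r :: "'g \<Rightarrow> real"
  assumes "finite F" "g \<in> F" "h \<in> F" "g + h \<in> F" "\<not> (g + h \<in> S \<longleftrightarrow> (g \<in> S \<longleftrightarrow> h \<in> S))"
  shows "pattern_mass r F S 0 = 0"
proof -
  have "pattern_mass r F S (g + h) = pattern_sign S h * (pattern_sign S g * pattern_mass r F S 0)"
    using pattern_mass_shift[OF assms(1,3), of r S g] pattern_mass_shift[OF assms(1,2), of r S 0] by simp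
  moreover have "pattern_mass r F S (g + h) = pattern_sign S (g + h) * pattern_mass r F S 0"
    using pattern_mass_shift[OF assms(1,4), of r S 0] by simp
  ultimately show ?thesis
    using assms(5) by (auto simp: pattern_sign_def split: if_splits)
qed

text \<open>The pattern weights of \<open>x\<close> define a regular measure on the Boolean cube; it
  is concentrated on the Boolean characters, and its image under the sign map is the required
  measure.\<close>

lemma representing_measure_exists:
  fixes x :: "'g \<Rightarrow> quat"
  assumes x: "x \<in> PH"
  shows "\<exists>\<mu>. radon_prob_on PH \<mu> \<and> emeasure \<mu> (PH - characters) = 0 \<and> barycenter \<mu> x"
proof -
  let ?r = "re_part x"
  have r: "real_pos_def ?r" "?r 0 = 1"
    using x by (simp_all add: PH_iff)
  interpret cylinder_content "\<lambda>F S. pattern_mass ?r F S 0"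
    by (rule cylinder_content_pattern_mass[OF r])
  obtain \<nu> :: "('g \<Rightarrow> bool) measure" where sets\<nu>: "sets \<nu> = sets borel" and pr: "prob_space \<nu>"
    and cyl: "\<And>F S. finite F \<Longrightarrow> S \<subseteq> F \<Longrightarrow> emeasure \<nu> (cyl F S) = pattern_mass ?r F S 0"
    and reg: "\<And>A. A \<in> sets borel \<Longrightarrow> emeasure \<nu> A = (SUP C\<in>{C. closed C \<and> C \<subseteq> A}. emeasure \<nu> C)"
    using regular_borel_measure_exists by blast
  interpret prob_space \<nu> by (rule pr)
  have sp\<nu>: "space \<nu> = UNIV"
    using sets_eq_imp_space_eq[OF sets\<nu>] by simp
  \<comment> \<open>The complement is a possibly uncountable union of open null sets
    \<open>B p\<close>, so countable additivity does not suffice; inner regularity reduces the claim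
    to compact subsets, which finitely many \<open>B p\<close> cover.\<close>
  have "emeasure \<nu> (- bool_characters) = 0"
  proof -
    define B :: "'g \<times> 'g \<Rightarrow> ('g \<Rightarrow> bool) set" where "B = (\<lambda>(g, h). \<Union>S\<in>{S. S \<subseteq> {g, h, g + h} \<and> \<not> (g + h \<in> S \<longleftrightarrow> (g \<in> S \<longleftrightarrow> h \<in> S))}.
      cyl {g, h, g + h} S)"
    have finS: "finite {S. S \<subseteq> {g, h, g + h} \<and> \<not> (g + h \<in> S \<longleftrightarrow> (g \<in> S \<longleftrightarrow> h \<in> S))}" for g h :: 'g
      by (rule finite_subset[of _ "Pow {g, h, g + h}"]) auto
    have openB: "open (B p)" for p
      by (auto simp: B_def split_def intro!: open_UN open_cyl)
    have nullB: "B p \<in> null_sets \<nu>" for p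
    proof -
      obtain g h where p: "p = (g, h)"
        by (cases p)
      have "cyl {g, h, g + h} S \<in> null_sets \<nu>"
        if "S \<subseteq> {g, h, g + h}" "\<not> (g + h \<in> S \<longleftrightarrow> (g \<in> S \<longleftrightarrow> h \<in> S))" for S
        using that pattern_mass_inconsistent[of "{g, h, g + h}" g h S ?r]
        by (intro null_setsI) (simp_all add: cyl sets\<nu> open_cyl)
      then show ?thesis
        unfolding p B_def prod.case
        by (intro null_sets_UN' countable_finite finS) auto
    qed
    have cover: "- bool_characters \<subseteq> (\<Union>p. B p)"
    proof
      fix b :: "'g \<Rightarrow> bool" assume "b \<in> - bool_characters"
      then obtain g h where gh: "\<not> (b (g + h) \<longleftrightarrow> (b g \<longleftrightarrow> b h))"
        by (auto simp: bool_characters_def)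
      let ?S = "{y \<in> {g, h, g + h}. b y}"
      have "b \<in> cyl {g, h, g + h} ?S" "\<not> (g + h \<in> ?S \<longleftrightarrow> (g \<in> ?S \<longleftrightarrow> h \<in> ?S))" "?S \<subseteq> {g, h, g + h}"
        using gh by (auto simp: cyl_def)
      then have "b \<in> B (g, h)"
        unfolding B_def prod.case by blast
      then show "b \<in> (\<Union>p. B p)"
        by blast
    qed
    have "emeasure \<nu> (- bool_characters) = (SUP C\<in>{C. closed C \<and> C \<subseteq> - bool_characters}. emeasure \<nu> C)"
      using closed_bool_characters by (intro reg) auto
    also have "\<dots> \<le> 0"
    proof (rule SUP_least)
      fix C assume "C \<in> {C. closed C \<and> C \<subseteq> - bool_characters}"
      then have C: "compact C" "C \<subseteq> (\<Union>p. B p)"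
        using cover closed_imp_compact_fun_bool by auto
      obtain D where D: "finite D" "C \<subseteq> (\<Union>p\<in>D. B p)"
        using compactE_image[OF C(1) openB C(2)] by metis
      have "(\<Union>p\<in>D. B p) \<in> null_sets \<nu>"
        using D nullB by (intro null_sets_UN' countable_finite) auto
      then show "emeasure \<nu> C \<le> 0"
        using D(2) emeasure_mono[of C "\<Union>p\<in>D. B p" \<nu>] by (auto simp: null_sets_def)
    qed
    finally show ?thesis by simp
  qed
  then have ae: "AE b in \<nu>. b \<in> bool_characters"
    using closed_bool_characters by (intro AE_I[of _ _ "- bool_characters"]) (auto simp: sets\<nu>)
  \<comment> \<open>The null set of non-characters is sent to the trivial character, so that
    \<open>T\<close> takes values in \<open>characters\<close> everywhere.\<close>
  define T where "T b = (if b \<in> bool_characters then sign_function b else sign_function (\<lambda>_. True))" for b :: "'g \<Rightarrow> bool"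
  have T_char: "T b \<in> characters" for b
    using sign_function_in_characters_iff[of b] sign_function_in_characters_iff[of "\<lambda>_. True"]
    by (auto simp: T_def bool_characters_def)
  define N where "N = restrict_space borel (PH :: ('g \<Rightarrow> quat) set)"
  have N: "space N = PH" "sets N = borel_on PH"
    by (simp_all add: N_def space_restrict_space borel_on_closed closed_PH)
  have T_borel: "T \<in> measurable \<nu> borel"
    unfolding T_def
  proof (rule measurable_If)
    have "sign_function \<in> measurable borel borel"
      by (rule borel_measurable_continuous_onI[OF continuous_on_sign_function])
    then show "sign_function \<in> measurable \<nu> borel"
      using measurable_cong_sets[OF sets\<nu> refl] by blast
    show "{b \<in> space \<nu>. b \<in> bool_characters} \<in> sets \<nu>"
      using closed_bool_characters by (simp add: sp\<nu> sets\<nu>)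
  qed simp
  then have T: "T \<in> measurable \<nu> N"
    unfolding N_def using T_char characters_subset_PH by (intro measurable_restrict_space2) auto
  define \<mu> where "\<mu> = distr \<nu> N T"
  have \<mu>: "space \<mu> = PH" "sets \<mu> = borel_on PH"
    by (simp_all add: \<mu>_def N)
  have em: "emeasure \<mu> A = emeasure \<nu> (T -` A)" if "A \<in> borel_on PH" for A
    using that T by (simp add: \<mu>_def emeasure_distr N sp\<nu>)
  have vim: "T -` A \<in> sets borel" if "A \<in> borel_on PH" for A
    using measurable_sets[OF T, of A] that by (simp add: N sp\<nu> sets\<nu>)
  have radon: "radon_prob_on PH \<mu>"
    unfolding radon_prob_on_def
  proof (intro conjI ballI \<mu>)
    show "prob_space \<mu>"
      unfolding \<mu>_def by (rule prob_space_distr[OF T])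
    fix A assume A: "A \<in> sets \<mu>"
    show "emeasure \<mu> A = (SUP C\<in>{C. C \<subseteq> A \<and> compactin (subtopology ptop PH) C}. emeasure \<mu> C)"
    proof (rule antisym)
      have TA: "T -` A \<in> sets borel"
        using A vim \<mu>(2) by simp
      have "emeasure \<mu> A = emeasure \<nu> (T -` A)"
        using A by (simp add: em \<mu>)
      \<comment> \<open>On Boolean characters \<open>T\<close> agrees with the continuous
        \<open>sign_function\<close>, so closed sets found there by regularity have compact
        images.\<close>
      also have "\<dots> = emeasure \<nu> (T -` A \<inter> bool_characters)"
      proof (rule emeasure_eq_AE)
        show "AE b in \<nu>. b \<in> T -` A \<longleftrightarrow> b \<in> T -` A \<inter> bool_characters"
          using ae by eventually_elim auto
      qed (use TA closed_bool_characters in \<open>auto simp: sets\<nu>\<close>)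
      also have "\<dots> = (SUP C\<in>{C. closed C \<and> C \<subseteq> T -` A \<inter> bool_characters}. emeasure \<nu> C)"
        using TA closed_bool_characters by (intro reg) auto
      also have "\<dots> \<le> (SUP C\<in>{C. C \<subseteq> A \<and> compactin (subtopology ptop PH) C}. emeasure \<mu> C)"
      proof (rule SUP_mono)
        fix C assume "C \<in> {C. closed C \<and> C \<subseteq> T -` A \<inter> bool_characters}"
        then have C: "closed C" "C \<subseteq> T -` A" "C \<subseteq> bool_characters"
          by auto
        have TC: "T ` C = sign_function ` C"
          using C(3) by (intro image_cong) (auto simp: T_def)
        have cpt: "compact (T ` C)"
          unfolding TC
          by (intro compact_continuous_image closed_imp_compact_fun_bool C(1)
              continuous_on_subset[OF continuous_on_sign_function]) auto
        have sub: "T ` C \<subseteq> PH"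
          using T_char characters_subset_PH by blast
        have TCs: "T ` C \<in> borel_on PH"
          by (rule closed_in_borel_on[OF closed_PH compact_imp_closed_fun[OF cpt] sub])
        have "emeasure \<nu> C \<le> emeasure \<mu> (T ` C)"
          unfolding em[OF TCs] using vim[OF TCs] by (intro emeasure_mono) (auto simp: sets\<nu>)
        then show "\<exists>C'\<in>{C. C \<subseteq> A \<and> compactin (subtopology ptop PH) C}. emeasure \<nu> C \<le> emeasure \<mu> C'"
          using cpt sub C(2) by (intro bexI[of _ "T ` C"]) (auto simp: compactin_PH_iff)
      qed
      finally show "emeasure \<mu> A \<le> (SUP C\<in>{C. C \<subseteq> A \<and> compactin (subtopology ptop PH) C}. emeasure \<mu> C)" .
      show "(SUP C\<in>{C. C \<subseteq> A \<and> compactin (subtopology ptop PH) C}. emeasure \<mu> C) \<le> emeasure \<mu> A"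
        using A by (intro SUP_least emeasure_mono) auto
    qed
  qed
  have null: "emeasure \<mu> (PH - characters) = 0"
  proof -
    have "PH - characters \<in> borel_on (PH :: ('g \<Rightarrow> quat) set)"
      using sets.compl_sets[of characters \<mu>]
        closed_in_borel_on[OF closed_PH closed_characters characters_subset_PH] by (simp add: \<mu>)
    moreover have "T -` (PH - characters) = {}"
      using T_char by auto
    ultimately show ?thesis
      by (simp add: em)
  qed
  \<comment> \<open>Almost everywhere the coordinate is a difference of two cylinder indicators;
    their masses \<open>(1 + ?r g) / 2\<close> and \<open>(1 - ?r g) / 2\<close> differ by
    \<open>?r g\<close>.\<close>
  have coord: "integrable \<nu> (\<lambda>b. re_part (T b) g) \<and> (\<integral>b. re_part (T b) g \<partial>\<nu>) = ?r g" for g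
  proof -
    let ?f = "\<lambda>b. indicator (cyl {g} {g}) b - indicator (cyl {g} {}) b :: real"
    have sets: "cyl {g} {g} \<in> sets \<nu>" "cyl {g} {} \<in> sets \<nu>"
      by (simp_all add: sets\<nu> open_cyl)
    have int: "integrable \<nu> ?f"
      using sets by (intro Bochner_Integration.integrable_diff) (auto simp: emeasure_eq_measure)
    have eq: "AE b in \<nu>. ?f b = re_part (T b) g"
      using ae by eventually_elim (auto simp: T_def re_part_sign_function cyl_def indicator_def)
    have "(\<lambda>\<phi>. re_part \<phi> g) \<in> borel_measurable borel"
      by (rule borel_measurable_continuous_onI[OF continuous_on_re_part])
    then have meas: "(\<lambda>b. re_part (T b) g) \<in> borel_measurable \<nu>"
      by (rule measurable_compose[OF T_borel])
    have "(\<integral>b. re_part (T b) g \<partial>\<nu>) = (\<integral>b. ?f b \<partial>\<nu>)"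
      using eq int meas by (intro integral_cong_AE) (auto elim: eventually_mono)
    also have "\<dots> = measure \<nu> (cyl {g} {g}) - measure \<nu> (cyl {g} {})"
      using sets by (subst Bochner_Integration.integral_diff) (auto simp: emeasure_eq_measure sp\<nu>)
    also have "\<dots> = pattern_mass ?r {g} {g} 0 - pattern_mass ?r {g} {} 0"
      using cyl[of "{g}" "{g}"] cyl[of "{g}" "{}"] nonneg[of "{g}" "{g}"] nonneg[of "{g}" "{}"]
      by (simp add: measure_def)
    also have "\<dots> = ?r g"
      by (simp add: pattern_mass_insert pattern_mass_empty pattern_sign_def field_simps)
    finally show ?thesis
      using integrable_cong_AE_imp[OF int meas] eq by auto
  qed
  have "barycenter \<mu> x"
    unfolding barycenter_def
  proof (intro allI impI)
    fix f :: "('g \<Rightarrow> quat) \<Rightarrow> real" assume f: "cont_lin_functional f"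
    obtain F a where F: "finite F"
      "\<And>y. (\<And>g. snd (y g) = 0) \<Longrightarrow> (\<And>g. Im (fst (y g)) = 0) \<Longrightarrow> f y = (\<Sum>g\<in>F. a g * re_part y g)"
      using cont_lin_functional_real_valued[OF f] by blast
    have fPH: "f y = (\<Sum>g\<in>F. a g * re_part y g)" if "y \<in> PH" for y
      using that by (intro F(2)) (auto simp: PH_iff)
    have fT: "(\<lambda>b. f (T b)) = (\<lambda>b. \<Sum>g\<in>F. a g * re_part (T b) g)"
      using T_char characters_subset_PH by (intro ext fPH) blast
    have meas: "f \<in> borel_measurable N"
      unfolding N_def by (intro measurable_restrict_space1 cont_lin_functional_borel_measurable f)
    have "integrable \<nu> (\<lambda>b. f (T b))"
      unfolding fT using coord by (intro Bochner_Integration.integrable_sum integrable_mult_right) auto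
    then have "integrable \<mu> f"
      unfolding \<mu>_def by (simp add: integrable_distr_eq[OF T meas])
    moreover have "(\<integral>y. f y \<partial>\<mu>) = (\<integral>b. f (T b) \<partial>\<nu>)"
      unfolding \<mu>_def by (rule integral_distr[OF T meas])
    moreover have "\<dots> = (\<Sum>g\<in>F. a g * ?r g)"
      unfolding fT using coord by (subst Bochner_Integration.integral_sum) auto
    ultimately show "integrable \<mu> f \<and> f x = (\<integral>y. f y \<partial>\<mu>)"
      using fPH[OF x] by simp
  qed
  with radon null show ?thesis
    by blast
qed

lemma bauer_simplex_PH: "bauer_simplex (PH :: ('g \<Rightarrow> quat) set)"
  unfolding bauer_simplex_def extreme_boundary_PH
proof (intro conjI ballI)
  show "compactin ptop (PH :: ('g \<Rightarrow> quat) set)"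
    using compact_PH by (simp add: ptop_eq_euclidean)
  show "fconvex (PH :: ('g \<Rightarrow> quat) set)"
    by (rule fconvex_PH)
  show "closedin ptop (characters :: ('g \<Rightarrow> quat) set)"
    using closed_characters by (simp add: ptop_eq_euclidean)
  fix x :: "'g \<Rightarrow> quat" assume "x \<in> PH"
  then show "\<exists>!\<mu>. radon_prob_on PH \<mu> \<and> emeasure \<mu> (PH - characters) = 0 \<and> barycenter \<mu> x"
    using representing_measure_exists representing_measure_unique by blast
qed

end

section \<open>Equivalence of the simplex property with exponent two\<close>

theorem mainTheorem16:
  shows "bauer_simplex (PH :: ('g::ab_group_add \<Rightarrow> quat) set) \<longleftrightarrow> (\<forall>g::'g. g + g = 0)"
proof
  assume "bauer_simplex (PH :: ('g \<Rightarrow> quat) set)"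
  then show "\<forall>g::'g. g + g = 0"
    using bauer_simplex_imp_exponent_two by blast
next
  assume "\<forall>g::'g. g + g = 0"
  then interpret exponent_two_group "TYPE('g)"
    by unfold_locales simp
  show "bauer_simplex (PH :: ('g \<Rightarrow> quat) set)"
    by (rule bauer_simplex_PH)
qed

end
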